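(* For every digraph $D$, the following identities hold as identities of rational functions in $x,y,z$: \[ \widehat{\sigma\pi}(D;x,y,z)=\left(\frac{y-1}{z-1}\right)^{-|V(D)|}\xi\!\left(D;\frac{y-1}{z-1},\,x\frac{y-1}{z-1},\,x\frac{(y-1)^2}{z-1}\right), \] \[ \xi(D;x,y,z)=x^{|V(D)|}\,\widehat{\sigma\pi}\!\left(D;\frac yx,\frac{y+z}{y},\frac{z}{xy}+1\right). \]
   Context: Digraphs are finite directed multigraphs; loops and multiple arcs are allowed. $E_n$ is the arcless digraph on $n$ vertices. The arc operations are as follows. $D_{-e}$ deletes $e$. If $e=(u,v)$ with $u\ne v$, then $D_{/e}$ removes all arcs with tail $u$ and all arcs with head $v$ (including $e$), and then identifies $u$ and $v$ into one new vertex. If $e=(u,u)$ is a loop, then $D_{/e}$ deletes $u$ and its incident arcs. For $e=(u,v)$, $D_{\dagger e}$ deletes $u$, $v$ and all arcs incident to them. The arc elimination polynomial $\xi(D;x,y,z)$ is the (well-defined) digraph invariant given by the following rules: \[ \xi(D)=\xi(D_{-e})+y\,\xi(D_{/e})+z\,\xi(D_{\dagger e}) \text{ for every arc } e, \] \[ \xi(D_1\cup D_2)=\xi(D_1)\xi(D_2),\qquad \xi(E_1)=x,\qquad \xi(E_0)=1. \] The trivariate cycle-path polynomial is \[ \widehat{\sigma\pi}(D;x,y,z)=\sum_F x^{|F|}y^{kc(D\langle F\rangle)}z^{kp(D\langle F\rangle)}, \] summed over all $F\subseteq E(D)$ in which every vertex has in-degree and out-degree at most 1 in the spanning subgraph $D\langle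 F\rangle=(V,F)$. Here $kc$ counts directed-cycle components (including loops), and $kp$ counts components that are directed paths with at least one arc. *)

theory Defs
  imports
    "Graph_Theory.Graph_Theory"
    "HOL-Computational_Algebra.Computational_Algebra"
begin

text \<open>
  A finite directed multigraph is a \<^term>\<open>D :: ('v, 'e) pre_digraph\<close> with
  \<^prop>\<open>fin_digraph D\<close>; loops, parallel arcs and the null graph are allowed.
  In a \<^type>\<open>pre_digraph\<close> the maps \<^const>\<open>tail\<close> and \<^const>\<open>head\<close> are total; their values
  outside \<^const>\<open>arcs\<close> are irrelevant, which \<^const>\<open>digraph_iso\<close> respects.
\<close>

section \<open>Polynomials and rational functions in three variables\<close>

text \<open>The innermost coefficients are polynomials in the first variable.\<close>

type_synonym poly3 = "int poly poly poly"

definition pX :: poly3 where "pX = [:[:[:0, 1:]:]:]"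
definition pY :: poly3 where "pY = [:[:0, 1:]:]"
definition pZ :: poly3 where "pZ = [:0, 1:]"

definition eval3 :: "poly3 \<Rightarrow> 'a::comm_ring_1 \<Rightarrow> 'a \<Rightarrow> 'a \<Rightarrow> 'a" where
  "eval3 p a b c =
     poly (map_poly (\<lambda>q. poly (map_poly (\<lambda>r. poly (map_poly of_int r) a) q) b) p) c"

text \<open>The fraction field of \<open>\<int>[x,y,z]\<close>, that is, the field \<open>\<rat>(x,y,z)\<close>.\<close>

type_synonym ratfun3 = "poly3 fract"

definition rX :: ratfun3 where "rX = to_fract pX"
definition rY :: ratfun3 where "rY = to_fract pY"
definition rZ :: ratfun3 where "rZ = to_fract pZ"

section \<open>Arc operations\<close>

text \<open>Arc deletion is \<^const>\<open>pre_digraph.del_arc\<close>.\<close>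

text \<open>
  For a non-loop \<open>e = (u,v)\<close> the vertex obtained by identifying \<open>u\<close> and \<open>v\<close> is named \<open>u\<close>.
\<close>

definition contract_arc :: "('v, 'e) pre_digraph \<Rightarrow> 'e \<Rightarrow> ('v, 'e) pre_digraph" where
  "contract_arc D e =
     (let u = tail D e; v = head D e; merge = (\<lambda>w. if w = v then u else w) in
      if u = v then pre_digraph.del_vert D u
      else \<lparr> verts = merge ` verts D,
             arcs = {a \<in> arcs D. tail D a \<noteq> u \<and> head D a \<noteq> v},
             tail = (\<lambda>a. merge (tail D a)),
             head = (\<lambda>a. merge (head D a)) \<rparr>)"

definition extract_arc :: "('v, 'e) pre_digraph \<Rightarrow> 'e \<Rightarrow> ('v, 'e) pre_digraph" where
  "extract_arc D e = pre_digraph.del_vert (pre_digraph.del_vert D (tail D e)) (head D e)"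

section \<open>The arc elimination polynomial\<close>

definition arcless :: "nat \<Rightarrow> ('v, 'e) pre_digraph \<Rightarrow> bool" where
  "arcless n D \<longleftrightarrow> fin_digraph D \<and> card (verts D) = n \<and> arcs D = {}"

text \<open>
  The library's \<^const>\<open>Digraph_Component.union\<close> is meaningful only for digraphs sharing their \<^const>\<open>tail\<close> and
  \<^const>\<open>head\<close> maps (\<^const>\<open>compatible\<close>); by isomorphism invariance this is no restriction on
  disjoint unions. Disjointness of the arc sets follows from that of the vertex sets.
\<close>

definition arc_elimination_invariant :: "(('v, 'e) pre_digraph \<Rightarrow> poly3) \<Rightarrow> bool" where
  "arc_elimination_invariant f \<longleftrightarrow>
     (\<forall>D D'. fin_digraph D \<longrightarrow> fin_digraph D' \<longrightarrow> digraph_iso D D' \<longrightarrow> f D = f D') \<and>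
     (\<forall>D. fin_digraph D \<longrightarrow> (\<forall>e \<in> arcs D.
        f D = f (pre_digraph.del_arc D e) + pY * f (contract_arc D e)
              + pZ * f (extract_arc D e))) \<and>
     (\<forall>D1 D2. fin_digraph D1 \<longrightarrow> fin_digraph D2 \<longrightarrow> compatible D1 D2 \<longrightarrow>
        verts D1 \<inter> verts D2 = {} \<longrightarrow> f (Digraph_Component.union D1 D2) = f D1 * f D2) \<and>
     (\<forall>D. arcless 1 D \<longrightarrow> f D = pX) \<and>
     (\<forall>D. arcless 0 D \<longrightarrow> f D = 1)"

text \<open>
  The rules determine an invariant only on finite digraphs, so the value at \<open>D\<close>, rather than
  the function, is what is described uniquely.
\<close>

definition arc_elimination_poly :: "('v, 'e) pre_digraph \<Rightarrow> poly3" where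
  "arc_elimination_poly D = (THE p. \<exists>f. arc_elimination_invariant f \<and> f D = p)"

section \<open>The trivariate cycle-path polynomial\<close>

definition spanning_sub :: "('v, 'e) pre_digraph \<Rightarrow> 'e set \<Rightarrow> ('v, 'e) pre_digraph" where
  "spanning_sub D F = D\<lparr>arcs := F\<rparr>"

text \<open>Note that \<^const>\<open>Digraph_Component.connected\<close> is connectedness of the underlying undirected graph.\<close>

definition components :: "('v, 'e) pre_digraph \<Rightarrow> ('v, 'e) pre_digraph set" where
  "components D = {C. pre_digraph.max_subgraph D Digraph_Component.connected C}"

text \<open>A loop and a pair of opposite arcs are directed cycles.\<close>

definition is_dicycle :: "('v, 'e) pre_digraph \<Rightarrow> bool" where
  "is_dicycle C \<longleftrightarrow> (\<exists>u p. pre_digraph.cycle C p \<and> pre_digraph.awalk C u p u \<and>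
     set p = arcs C \<and> set (pre_digraph.awalk_verts C u p) = verts C)"

definition is_nontrivial_dipath :: "('v, 'e) pre_digraph \<Rightarrow> bool" where
  "is_nontrivial_dipath C \<longleftrightarrow> (\<exists>u p v. pre_digraph.apath C u p v \<and> p \<noteq> [] \<and>
     set p = arcs C \<and> set (pre_digraph.awalk_verts C u p) = verts C)"

definition kc :: "('v, 'e) pre_digraph \<Rightarrow> nat" where
  "kc D = card {C \<in> components D. is_dicycle C}"

definition kp :: "('v, 'e) pre_digraph \<Rightarrow> nat" where
  "kp D = card {C \<in> components D. is_nontrivial_dipath C}"

definition cycle_path_sets :: "('v, 'e) pre_digraph \<Rightarrow> 'e set set" where
  "cycle_path_sets D = {F. F \<subseteq> arcs D \<and> (\<forall>v \<in> verts D.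
     in_degree (spanning_sub D F) v \<le> 1 \<and> out_degree (spanning_sub D F) v \<le> 1)}"

definition cycle_path_poly :: "('v, 'e) pre_digraph \<Rightarrow> poly3" where
  "cycle_path_poly D = (\<Sum>F \<in> cycle_path_sets D.
     pX ^ card F * pY ^ kc (spanning_sub D F) * pZ ^ kp (spanning_sub D F))"

end

theory Submission
  imports Defs
begin

text \<open>
  Clearing denominators in the second identity gives a polynomial \<open>\<Xi>(D)\<close>, a sum over the arc sets \<open>F\<close>
  on which tail and head are injective. It satisfies the rules defining \<open>\<xi>\<close>: the sets \<open>F\<close> avoiding an
  arc \<open>e\<close> give \<open>\<Xi>(D - e)\<close>. If \<open>F\<close> contains a non-loop \<open>e\<close>, contracting \<open>e\<close> keeps the numbers of cycles,
  nontrivial paths and isolated vertices and costs a factor \<open>y\<close>, unless \<open>e\<close> is a path component of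
  its own: then its factor \<open>z + xy\<close> splits into \<open>z\<close> (extraction) and \<open>y\<close> times the \<open>x\<close> of the new
  isolated vertex (contraction). A loop in \<open>F\<close> contributes \<open>y + z\<close>. By induction on the number of arcs the
  rules determine \<open>\<xi>\<close>, so \<open>\<xi> = \<Xi>\<close>, and both identities hold term by term.
\<close>

section \<open>Components via cuts\<close>

text \<open>Connectedness is reachability in the symmetric closure: a walk cannot leave a vertex set
  that no arc crosses, and the set of vertices reachable from \<open>u\<close> is crossed by no arc.
  The criterion spares later proofs the handling of undirected walks.\<close>

lemma connected_iff_no_cut:
  assumes "wf_digraph C"
  shows "Digraph_Component.connected C \<longleftrightarrow> verts C \<noteq> {} \<and>
    (\<forall>S \<subseteq> verts C. S \<noteq> {} \<longrightarrow> (\<forall>a \<in> arcs C. tail C a \<in> S \<longleftrightarrow> head C a \<in> S) \<longrightarrow> S = verts C)"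
    (is "_ \<longleftrightarrow> _ \<and> ?cut")
proof -
  interpret wf_digraph C by fact
  interpret S: pair_wf_digraph "mk_symmetric C" by (rule wellformed_mk_symmetric)
  show ?thesis
  proof (intro iffI conjI allI impI)
    assume c: "Digraph_Component.connected C"
    then show "verts C \<noteq> {}"
      by (auto simp: connected_def strongly_connected_def)
    fix S assume S: "S \<subseteq> verts C" "S \<noteq> {}" "\<forall>a \<in> arcs C. tail C a \<in> S \<longleftrightarrow> head C a \<in> S"
    from S obtain u where u: "u \<in> S" by auto
    show "S = verts C"
    proof (intro equalityI subsetI)
      fix v assume "v \<in> verts C"
      then have "u \<rightarrow>\<^sup>*\<^bsub>mk_symmetric C\<^esub> v"
        using c u S by (auto simp: connected_def strongly_connected_def)
      then show "v \<in> S"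
        by (induction rule: S.reachable_induct) (use u S in \<open>auto simp: parcs_mk_symmetric\<close>)
    qed (use S in auto)
  next
    assume c: "verts C \<noteq> {} \<and> ?cut"
    show "Digraph_Component.connected C"
      unfolding connected_def
    proof (rule strongly_connectedI)
      fix u v assume "u \<in> verts (mk_symmetric C)" "v \<in> verts (mk_symmetric C)"
      then have uv: "u \<in> verts C" "v \<in> verts C" by auto
      let ?S = "{w. u \<rightarrow>\<^sup>*\<^bsub>mk_symmetric C\<^esub> w}"
      have "u \<in> ?S" using uv by auto
      moreover have "tail C a \<in> ?S \<longleftrightarrow> head C a \<in> ?S" if a: "a \<in> arcs C" for a
      proof -
        have 1: "(tail C a, head C a) \<in> parcs (mk_symmetric C)" "(head C a, tail C a) \<in> parcs (mk_symmetric C)"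
          using a by (auto simp: parcs_mk_symmetric)
        show ?thesis using S.reachable_adj_trans[OF _ 1(1)] S.reachable_adj_trans[OF _ 1(2)] by blast
      qed
      moreover have "?S \<subseteq> verts C"
        using S.reachable_in_verts(2) by auto
      ultimately have "?S = verts C" using c by blast
      then show "u \<rightarrow>\<^sup>*\<^bsub>mk_symmetric C\<^esub> v" using uv by blast
    qed (use c in auto)
  qed
qed

section \<open>Directed walks and the vertices they visit\<close>

text \<open>A vertex set that no arc crosses contains all vertices of a walk or none of
  them.\<close>

lemma (in wf_digraph) connected_if_awalk_spans:
  assumes "awalk u p v" "set (awalk_verts u p) = verts G"
  shows "Digraph_Component.connected G"
proof -
  have *: "w \<in> S \<longleftrightarrow> u \<in> S"
    if "awalk u p v" "\<forall>a \<in> arcs G. tail G a \<in> S \<longleftrightarrow> head G a \<in> S" "w \<in> set (awalk_verts u p)"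
    for w S u p
    using that by (induction p arbitrary: u) (auto simp: awalk_Nil_iff awalk_Cons_iff)
  show ?thesis
    unfolding connected_iff_no_cut[OF wf_digraph]
  proof (intro conjI allI impI)
    show "verts G \<noteq> {}" using assms by auto
    fix S assume S: "S \<subseteq> verts G" "S \<noteq> {}" "\<forall>a \<in> arcs G. tail G a \<in> S \<longleftrightarrow> head G a \<in> S"
    show "S = verts G" using S *[OF assms(1) S(3)] assms(2) by blast
  qed
qed

text \<open>Both sides are the set of visited vertices: the tails can miss only the last one, the
  heads only the first.\<close>

lemma (in pre_digraph) cas_insert_ends:
  "cas u p v \<Longrightarrow> insert v (tail G ` set p) = insert u (head G ` set p)"
proof (induction p arbitrary: u)
  case (Cons a p)
  from Cons.IH[of "head G a"] Cons.prems show ?case by auto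
qed auto

lemma (in pre_digraph) closed_cas_tails_eq_heads:
  assumes "cas u p u"
  shows "tail G ` set p = head G ` set p"
proof (cases "p = []")
  case False
  have "u = tail G (hd p)" using assms False by (cases p) auto
  then have "u \<in> tail G ` set p" using False by auto
  moreover have "u \<in> head G ` set p"
  proof -
    have "cas u (butlast p @ [last p]) u" using assms False by simp
    then have "head G (last p) = u" unfolding cas_append_iff by simp
    then show ?thesis using False by force
  qed
  ultimately show ?thesis using cas_insert_ends[OF assms] by (simp add: insert_absorb)
qed auto

text \<open>The vertices of a path are its tails followed by its end vertex, and they are
  distinct.\<close>

lemma (in wf_digraph) apath_tail_neq_last:
  assumes "apath u p v" "a \<in> set p"
  shows "tail G a \<noteq> v"
proof -
  have "p \<noteq> []" using assms by auto
  moreover have "awlast u p = v" using assms by (auto simp: apath_def)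
  ultimately have "head G (last p) = v" by (auto simp: awalk_verts_conv)
  then show ?thesis
    using assms \<open>p \<noteq> []\<close> unfolding apath_def by (auto simp: awalk_verts_conv) (metis imageI)
qed

lemma (in wf_digraph) apath_verts_conv:
  assumes "apath u p v"
  shows "awalk_verts u p = u # map (head G) p"
proof -
  have c: "cas u p v" using assms by (auto simp: apath_def)
  show ?thesis
    using awalk_verts_conv'[OF c] c by (cases p) auto
qed

section \<open>Components as connected subgraphs that absorb incident arcs\<close>

lemma max_subgraph_fields:
  assumes "pre_digraph.max_subgraph H P C"
  shows "verts C \<subseteq> verts H" "arcs C \<subseteq> arcs H" "wf_digraph C" "tail C = tail H" "head C = head H"
  using assms by (auto simp: pre_digraph.max_subgraph_def subgraph_def compatible_def)

text \<open>An incident arc missing from \<open>C\<close> could be added without losing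
  connectedness, against maximality. Conversely, if \<open>C\<close> absorbs incident arcs, no arc
  crosses its vertex set, so a connected supergraph has no further vertices.\<close>

lemma components_iff:
  assumes "wf_digraph H"
  shows "C \<in> components H \<longleftrightarrow> subgraph C H \<and> Digraph_Component.connected C \<and>
    (\<forall>a \<in> arcs H. tail H a \<in> verts C \<or> head H a \<in> verts C \<longrightarrow> a \<in> arcs C)"
    (is "_ \<longleftrightarrow> _ \<and> _ \<and> ?absorb")
proof -
  interpret wf_digraph H by fact
  show ?thesis
  proof (intro iffI)
    assume "C \<in> components H"
    then have C: "max_subgraph Digraph_Component.connected C" by (simp add: components_def)
    note f = max_subgraph_fields[OF C]
    have sub: "subgraph C H" and con: "Digraph_Component.connected C"
      and mx: "\<And>C'. subgraph C C' \<Longrightarrow> subgraph C' H \<Longrightarrow> Digraph_Component.connected C' \<Longrightarrow> C' = C"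
      using C by (auto simp: max_subgraph_def)
    note cut = con[unfolded connected_iff_no_cut[OF f(3)]]
    have "a \<in> arcs C" if a: "a \<in> arcs H" "tail H a \<in> verts C \<or> head H a \<in> verts C" for a
    proof -
      let ?C = "\<lparr>verts = insert (tail H a) (insert (head H a) (verts C)), arcs = insert a (arcs C),
        tail = tail H, head = head H\<rparr>"
      have wf: "wf_digraph ?C"
        using wf_digraph.wellformed[OF f(3)] f by unfold_locales auto
      have "subgraph C ?C" "subgraph ?C H"
        using f a wf wf_digraph by (auto simp: subgraph_def compatible_def)
      moreover have "Digraph_Component.connected ?C"
        unfolding connected_iff_no_cut[OF wf]
      proof (intro conjI allI impI)
        fix S assume S: "S \<subseteq> verts ?C" "S \<noteq> {}"
          "\<forall>b \<in> arcs ?C. tail ?C b \<in> S \<longleftrightarrow> head ?C b \<in> S"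
        \<comment> \<open>If \<open>S\<close> contains one end of \<open>a\<close> it contains both,
          and one of them lies in \<open>C\<close>.\<close>
        have "S \<inter> verts C \<noteq> {}" using S a(2) by auto
        moreover have "tail C b \<in> S \<inter> verts C \<longleftrightarrow> head C b \<in> S \<inter> verts C" if "b \<in> arcs C" for b
          using that S wf_digraph.wellformed[OF f(3) that] f by auto
        ultimately have "S \<inter> verts C = verts C" using cut by blast
        then show "S = verts ?C" using S a(2) by auto
      qed auto
      ultimately have "?C = C" by (rule mx)
      then have "arcs ?C = arcs C" by metis
      then show ?thesis by auto
    qed
    then show "subgraph C H \<and> Digraph_Component.connected C \<and> ?absorb" using sub con by auto
  next
    assume R: "subgraph C H \<and> Digraph_Component.connected C \<and> ?absorb"
    have "C' = C" if C': "subgraph C C'" "subgraph C' H" "Digraph_Component.connected C'" for C'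
    proof -
      have wf: "wf_digraph C'" using C' by auto
      have eqs: "tail C = tail H" "head C = head H" "tail C' = tail H" "head C' = head H"
        using R C' by (auto simp: subgraph_def compatible_def)
      have sub: "verts C \<subseteq> verts C'" "arcs C \<subseteq> arcs C'" "arcs C' \<subseteq> arcs H" "wf_digraph C"
        using C' R by (auto simp: subgraph_def)
      have "verts C \<noteq> {}"
        using R connected_iff_no_cut[OF sub(4)] by blast
      moreover have "\<forall>a \<in> arcs C'. tail C' a \<in> verts C \<longleftrightarrow> head C' a \<in> verts C"
        using R sub eqs wf_digraph.wellformed[OF sub(4)] by (metis subsetD)
      ultimately have v: "verts C = verts C'"
        using C'(3) sub(1) unfolding connected_iff_no_cut[OF wf] by blast
      moreover have "arcs C' \<subseteq> arcs C"
        using R sub eqs wf_digraph.wellformed[OF wf] v by (metis subsetD subsetI)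
      ultimately show ?thesis using eqs sub by (intro pre_digraph.equality) auto
    qed
    then show "C \<in> components H"
      using R by (auto simp: components_def max_subgraph_def)
  qed
qed

text \<open>No arc of \<open>C\<close> crosses the common vertex set, because \<open>C'\<close>
  absorbs incident arcs; connectedness of \<open>C\<close> makes this set all of
  \<open>verts C\<close>. Exchanging the roles gives equality.\<close>

lemma components_eq_if_common_vertex:
  assumes "wf_digraph H" "C \<in> components H" "C' \<in> components H" "w \<in> verts C" "w \<in> verts C'"
  shows "C = C'"
proof -
  have *: "verts C \<subseteq> verts C' \<and> arcs C \<subseteq> arcs C'"
    if C: "C \<in> components H" and C': "C' \<in> components H" and w: "w \<in> verts C" "w \<in> verts C'" for C C'
  proof -
    have sub: "subgraph C H" "subgraph C' H" and con: "Digraph_Component.connected C"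
      and abs: "\<And>a. a \<in> arcs H \<Longrightarrow> tail H a \<in> verts C' \<or> head H a \<in> verts C' \<Longrightarrow> a \<in> arcs C'"
      using C C' by (auto simp: components_iff[OF assms(1)])
    have eqs: "tail C = tail H" "head C = head H" "tail C' = tail H" "head C' = head H"
      and wf: "wf_digraph C" "wf_digraph C'" and "arcs C \<subseteq> arcs H"
      using sub by (auto simp: subgraph_def compatible_def)
    have "\<forall>a \<in> arcs C. tail C a \<in> verts C \<inter> verts C' \<longleftrightarrow> head C a \<in> verts C \<inter> verts C'"
    proof
      fix a assume a: "a \<in> arcs C"
      then have "a \<in> arcs H" using \<open>arcs C \<subseteq> arcs H\<close> by auto
      from abs[OF this] show "tail C a \<in> verts C \<inter> verts C' \<longleftrightarrow> head C a \<in> verts C \<inter> verts C'"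
        using wf_digraph.wellformed[OF wf(1) a] wf_digraph.wellformed[OF wf(2), of a] unfolding eqs by blast
    qed
    moreover have "verts C \<inter> verts C' \<noteq> {}" using w by auto
    ultimately have "verts C \<inter> verts C' = verts C"
      using con unfolding connected_iff_no_cut[OF wf(1)] by blast
    then have "verts C \<subseteq> verts C'" by auto
    moreover from this have "arcs C \<subseteq> arcs C'"
      using abs eqs \<open>arcs C \<subseteq> arcs H\<close> wf_digraph.wellformed[OF wf(1)] by (metis subsetD subsetI)
    ultimately show ?thesis by auto
  qed
  have "subgraph C H" "subgraph C' H" using assms by (auto simp: components_iff[OF assms(1)])
  then have "tail C = tail C'" "head C = head C'"
    by (auto simp: subgraph_def compatible_def)
  then show ?thesis
    using *[OF assms(2-5)] *[OF assms(3,2,5,4)] by (intro pre_digraph.equality) auto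
qed

section \<open>Cycles and paths of a digraph with degrees at most one\<close>

definition balanced :: "('e \<Rightarrow> 'v) \<Rightarrow> ('e \<Rightarrow> 'v) \<Rightarrow> 'e set \<Rightarrow> 'e set set" where
  "balanced t h F = {A. A \<subseteq> F \<and> t ` A = h ` A}"

text \<open>Stated for an arbitrary set family, so that cycle counts can be compared along any
  inclusion-preserving bijection of families.\<close>

definition atoms :: "'a set set \<Rightarrow> 'a set set" where
  "atoms P = {A \<in> P. A \<noteq> {} \<and> (\<forall>B \<in> P. B \<subseteq> A \<longrightarrow> B \<noteq> {} \<longrightarrow> B = A)}"

text \<open>
  If both end maps are injective on \<open>F\<close>, a balanced set is a union of directed cycles, and the
  atoms are the arc sets of the cycles.
\<close>

abbreviation cycs :: "('e \<Rightarrow> 'v) \<Rightarrow> ('e \<Rightarrow> 'v) \<Rightarrow> 'e set \<Rightarrow> 'e set set" where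
  "cycs t h F \<equiv> atoms (balanced t h F)"

lemma cycs_iff:
  "A \<in> cycs t h F \<longleftrightarrow> A \<subseteq> F \<and> A \<noteq> {} \<and> t ` A = h ` A \<and>
    (\<forall>B. B \<subseteq> A \<longrightarrow> B \<noteq> {} \<longrightarrow> t ` B = h ` B \<longrightarrow> B = A)"
  unfolding atoms_def balanced_def Ball_def mem_Collect_eq by (meson order_trans)

text \<open>Injectivity of the two end maps expresses that out-degrees and in-degrees are at most
  one.\<close>

locale cycle_path_digraph = fin_digraph +
  assumes inj_tail: "inj_on (tail G) (arcs G)" and inj_head: "inj_on (head G) (arcs G)"
begin

text \<open>A longest path from \<open>u\<close> works: an arc leaving its end must return to the
  path, and every path vertex except \<open>u\<close> already has its only incoming arc on the path.
  Within a balanced arc set such a path closes to a cycle; from a vertex of in-degree zero it runs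
  through a whole path component.\<close>

lemma ex_maximal_apath:
  assumes "u \<in> verts G"
  shows "\<exists>p v. apath u p v \<and> (\<forall>a \<in> arcs G. tail G a = v \<longrightarrow> head G a = u)"
proof -
  let ?Q = "\<lambda>p. \<exists>v. apath u p v"
  have "?Q []" using assms by (auto simp: apath_Nil_iff)
  moreover have "\<forall>p. ?Q p \<longrightarrow> length p < card (verts G)"
    using length_apath_less by auto
  ultimately obtain p where p: "?Q p" and mx: "\<And>q. ?Q q \<Longrightarrow> length q \<le> length p"
    using ex_has_greatest_nat[of ?Q "[]" length "card (verts G)"] by blast
  from p obtain v where v: "apath u p v" by auto
  have "head G a = u" if a: "a \<in> arcs G" "tail G a = v" for a
  proof (rule ccontr)
    assume "head G a \<noteq> u"
    have "head G a \<in> set (awalk_verts u p)"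
    proof (rule ccontr)
      assume new: "head G a \<notin> set (awalk_verts u p)"
      have "awlast u p = v" using v by (auto simp: apath_def)
      moreover have "v \<noteq> head G a"
        using new v by (metis apath_def awalkE' awalk_verts_non_Nil last_in_set)
      ultimately have "apath u (p @ [a]) (head G a)"
        using v a new by (auto simp: apath_append_iff apath_simps)
      then show False using mx[of "p @ [a]"] by auto
    qed
    \<comment> \<open>By injectivity of \<open>head G\<close> the arc \<open>a\<close> equals
      \<open>b\<close> and lies on the path, yet no path arc leaves the end
      \<open>v\<close>.\<close>
    then obtain b where "b \<in> set p" "head G a = head G b"
      using \<open>head G a \<noteq> u\<close> v by (auto simp: apath_verts_conv)
    moreover have "b \<in> arcs G" using \<open>b \<in> set p\<close> v by (auto simp: apath_def)
    ultimately have "a \<in> set p" using a inj_head by (auto dest: inj_onD)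
    then show False using apath_tail_neq_last[OF v] a by auto
  qed
  then show ?thesis using v by auto
qed

text \<open>A nonempty balanced part of a cycle component spans a vertex set that no arc crosses,
  hence is the whole cycle. Conversely, a minimal balanced set contains a cycle, whose arcs are
  balanced and therefore exhaust the set.\<close>

lemma bij_betw_dicycles:
  "bij_betw arcs {C \<in> components G. is_dicycle C} (cycs (tail G) (head G) (arcs G))"
  unfolding bij_betw_def
proof (intro conjI equalityI subsetI)
  have dicycleD: "arcs C \<noteq> {}" "tail C ` arcs C = head C ` arcs C" if "is_dicycle C" for C :: "('a, 'b) pre_digraph"
  proof -
    from that obtain u p where p: "pre_digraph.cycle C p" "pre_digraph.awalk C u p u" "set p = arcs C"
      by (auto simp: is_dicycle_def)
    show "arcs C \<noteq> {}" using p by (auto simp: pre_digraph.cycle_def)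
    show "tail C ` arcs C = head C ` arcs C"
      using pre_digraph.closed_cas_tails_eq_heads[of C u p] p by (auto simp: pre_digraph.awalk_def)
  qed
  have compD: "wf_digraph C" "tail C = tail G" "head C = head G" "arcs C \<subseteq> arcs G"
    "Digraph_Component.connected C" if "C \<in> components G" for C
    using that by (auto simp: components_iff[OF wf_digraph] subgraph_def compatible_def)
  show "inj_on arcs {C \<in> components G. is_dicycle C}"
  proof (rule inj_onI)
    fix C C' assume C: "C \<in> {C \<in> components G. is_dicycle C}" "C' \<in> {C \<in> components G. is_dicycle C}"
      and eq: "arcs C = arcs C'"
    then obtain a where "a \<in> arcs C" using dicycleD by blast
    then have "tail G a \<in> verts C" "tail G a \<in> verts C'"
      using C eq wf_digraph.wellformed[OF compD(1)[of C]] wf_digraph.wellformed[OF compD(1)[of C']]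
        compD(2)[of C] compD(2)[of C'] by auto
    then show "C = C'" using C components_eq_if_common_vertex[OF wf_digraph] by auto
  qed
  fix A
  {
    assume "A \<in> arcs ` {C \<in> components G. is_dicycle C}"
    then obtain C where C: "C \<in> components G" "is_dicycle C" "A = arcs C" by auto
    note f = compD[OF C(1)]
    have "B = A" if B: "B \<subseteq> A" "B \<noteq> {}" "tail G ` B = head G ` B" for B
    proof -
      \<comment> \<open>Since \<open>B\<close> is balanced, its tails are all its vertices; an arc
        that starts or ends among them lies in \<open>B\<close> by injectivity.\<close>
      have *: "a \<in> B" if "a \<in> arcs C" "tail G a \<in> tail G ` B" for a
        using that f(4) B(1) C(3) inj_on_image_mem_iff[OF inj_tail, of a B] by auto
      have **: "a \<in> B" if "a \<in> arcs C" "head G a \<in> tail G ` B" for a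
        using that f(4) B C(3) inj_on_image_mem_iff[OF inj_head, of a B] by auto
      have "\<forall>a \<in> arcs C. tail C a \<in> tail G ` B \<longleftrightarrow> head C a \<in> tail G ` B"
        using * ** B(3) f by (metis imageI)
      moreover have "tail G ` B \<subseteq> verts C" using B(1) C(3) f wf_digraph.wellformed[OF f(1)] by auto
      ultimately have "tail G ` B = verts C"
        using f(5) B(2) unfolding connected_iff_no_cut[OF f(1)] by (metis image_is_empty)
      then have "A \<subseteq> B" using * C(3) f wf_digraph.wellformed[OF f(1)] by auto
      then show ?thesis using B by auto
    qed
    then show "A \<in> cycs (tail G) (head G) (arcs G)"
      using C f dicycleD[OF C(2)] by (simp add: cycs_iff)
  next
    assume "A \<in> cycs (tail G) (head G) (arcs G)"
    then have A: "A \<subseteq> arcs G" "A \<noteq> {}" "tail G ` A = head G ` A"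
      and min: "\<And>B. B \<subseteq> A \<Longrightarrow> B \<noteq> {} \<Longrightarrow> tail G ` B = head G ` B \<Longrightarrow> B = A"
      by (simp_all add: cycs_iff)
    \<comment> \<open>Taking the longest path inside \<open>?K\<close> keeps all its arcs in
      \<open>A\<close>.\<close>
    let ?K = "\<lparr>verts = head G ` A, arcs = A, tail = tail G, head = head G\<rparr>"
    have "finite A" using A finite_arcs finite_subset by blast
    interpret K: cycle_path_digraph ?K
      using A \<open>finite A\<close> inj_on_subset[OF inj_tail] inj_on_subset[OF inj_head]
      by unfold_locales auto
    obtain u where u: "u \<in> verts ?K" using A by auto
    then obtain p v where p: "K.apath u p v" "\<forall>a \<in> A. tail G a = v \<longrightarrow> head G a = u"
      using K.ex_maximal_apath[OF u] by auto
    have w: "K.awalk u p v" using p by (auto simp: K.apath_def)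
    have "v \<in> head G ` A" using w by auto
    \<comment> \<open>Balance provides an arc of \<open>A\<close> out of the end vertex; by the
      choice of the path it leads back to \<open>u\<close>.\<close>
    then obtain a where a: "a \<in> A" "tail G a = v" using A by (metis imageE)
    have cl: "K.awalk u (p @ [a]) u"
      using w a p(2) by (intro K.awalk_appendI[OF w]) (auto simp: K.awalk_simps)
    have "distinct (tl (K.awalk_verts u (p @ [a])))"
      using p(1) K.apath_verts_conv[OF p(1)] K.awalk_verts_append[OF cl] w a p(2)
      by (auto simp: K.apath_def)
    then have cyc: "K.cycle (p @ [a])" using cl by (auto simp: K.cycle_def)
    have eqA: "set (p @ [a]) = A"
    proof (rule min)
      have "set p \<subseteq> A" using w unfolding K.awalk_def by simp
      then show "set (p @ [a]) \<subseteq> A" using a by auto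
      show "tail G ` set (p @ [a]) = head G ` set (p @ [a])"
        using K.closed_cas_tails_eq_heads[of u "p @ [a]"] cl unfolding K.awalk_def by simp
    qed auto
    have vs: "set (K.awalk_verts u (p @ [a])) = verts ?K"
      using K.set_awalk_verts_not_Nil[OF cl] eqA A by auto
    have "?K \<in> components G"
      unfolding components_iff[OF wf_digraph]
    proof (intro conjI ballI impI)
      show "subgraph ?K G"
        using A wf_digraph K.wf_digraph by (auto simp: subgraph_def compatible_def)
      show "Digraph_Component.connected ?K"
        using K.connected_if_awalk_spans[OF cl vs] .
      fix b assume b: "b \<in> arcs G" "tail G b \<in> verts ?K \<or> head G b \<in> verts ?K"
      then have "tail G b \<in> tail G ` A \<or> head G b \<in> head G ` A" using A by simp
      then show "b \<in> arcs ?K"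
        using inj_on_image_mem_iff[OF inj_tail b(1) A(1)] inj_on_image_mem_iff[OF inj_head b(1) A(1)]
        by auto
    qed
    moreover have "is_dicycle ?K"
      unfolding is_dicycle_def using cyc cl eqA vs by (intro exI[of _ u] exI[of _ "p @ [a]"]) auto
    ultimately show "A \<in> arcs ` {C \<in> components G. is_dicycle C}" by force
  }
qed

lemma kc_eq: "kc G = card (cycs (tail G) (head G) (arcs G))"
  unfolding kc_def by (rule bij_betw_same_card[OF bij_betw_dicycles])

text \<open>Nontrivial path components are counted by their start vertices, the vertices with an
  outgoing but no incoming arc.\<close>

lemma kp_eq: "kp G = card (tail G ` arcs G - head G ` arcs G)"
proof -
  let ?P = "tail G ` arcs G - head G ` arcs G"
  let ?CC = "{C \<in> components G. is_nontrivial_dipath C}"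
  \<comment> \<open>Every vertex of the path after \<open>u\<close> is the head of a path arc, and
    an arc of \<open>G\<close> into \<open>u\<close> would be absorbed by \<open>C\<close>.\<close>
  have start: "verts C \<inter> ?P = {u}"
    if C: "C \<in> components G" and p: "pre_digraph.apath C u p v" "p \<noteq> []" "set p = arcs C"
      "set (pre_digraph.awalk_verts C u p) = verts C" for C u p v
  proof -
    have f: "wf_digraph C" "tail C = tail G" "head C = head G" "arcs C \<subseteq> arcs G"
      and abs: "\<And>a. a \<in> arcs G \<Longrightarrow> head G a \<in> verts C \<Longrightarrow> a \<in> arcs C"
      using C by (auto simp: components_iff[OF wf_digraph] subgraph_def compatible_def)
    interpret C: wf_digraph C by fact
    have av: "C.awalk_verts u p = u # map (head G) p"
      using C.apath_verts_conv[OF p(1)] f by auto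
    have u: "u = tail G (hd p)" using p f by (cases p) (auto simp: C.apath_Cons_iff)
    have "u \<notin> head G ` arcs C" using p(1,3) av by (auto simp: C.apath_def)
    moreover have "u \<in> verts C" using av p(4) by auto
    ultimately have "u \<notin> head G ` arcs G" using abs by auto
    moreover have "u \<in> tail G ` arcs G" using u p(2,3) f by (metis hd_in_set imageI subsetD)
    moreover have "w = u" if "w \<in> verts C" "w \<notin> head G ` arcs G" for w
      using that f(4) p(3)[symmetric] unfolding p(4)[symmetric] av by auto
    ultimately show ?thesis using \<open>u \<in> verts C\<close> by blast
  qed
  have im: "(\<lambda>C. verts C \<inter> ?P) ` ?CC = (\<lambda>u. {u}) ` ?P"
  proof (intro equalityI subsetI)
    fix X assume "X \<in> (\<lambda>C. verts C \<inter> ?P) ` ?CC"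
    then obtain C where C: "C \<in> ?CC" "X = verts C \<inter> ?P" by auto
    then obtain u p v where "pre_digraph.apath C u p v" "p \<noteq> []" "set p = arcs C"
      "set (pre_digraph.awalk_verts C u p) = verts C" by (auto simp: is_nontrivial_dipath_def)
    then have "verts C \<inter> ?P = {u}" using start C by auto
    then have "X = {u}" "u \<in> ?P" using C(2) by blast+
    then show "X \<in> (\<lambda>u. {u}) ` ?P" by (rule image_eqI)
  next
    fix X assume "X \<in> (\<lambda>u. {u}) ` ?P"
    then obtain u where u: "u \<in> ?P" "X = {u}" by auto
    then have "u \<in> verts G" by auto
    from ex_maximal_apath[OF this]
    obtain p v where p: "apath u p v" "\<forall>a \<in> arcs G. tail G a = v \<longrightarrow> head G a = u"
      by auto
    have w: "awalk u p v" using p by (auto simp: apath_def)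
    \<comment> \<open>An arc out of \<open>v\<close> would have to enter \<open>u\<close>, which has
      no incoming arc.\<close>
    have ends: "\<And>a. a \<in> arcs G \<Longrightarrow> tail G a \<noteq> v" using p(2) u by (metis DiffE imageI)
    then have "p \<noteq> []" using w u by (auto simp: awalk_Nil_iff)
    let ?C = "\<lparr>verts = set (awalk_verts u p), arcs = set p, tail = tail G, head = head G\<rparr>"
    interpret C: wf_digraph ?C
      using w by unfold_locales (auto simp: awalk_verts_arc1 awalk_verts_arc2)
    have comp: "compatible ?C G" by (auto simp: compatible_def)
    have avC: "C.awalk_verts = awalk_verts" and casC: "C.cas = cas"
      using compatible_awalk_verts[OF comp] compatible_cas[OF comp] by auto
    have apC: "C.apath u p v"
      using p(1) hd_in_awalk_verts(1)[OF w]
      unfolding C.apath_def apath_def C.awalk_def awalk_def avC casC by simp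
    have "?C \<in> components G"
      unfolding components_iff[OF wf_digraph]
    proof (intro conjI ballI impI)
      show "subgraph ?C G"
        using w C.wf_digraph wf_digraph by (auto simp: subgraph_def compatible_def)
      show "Digraph_Component.connected ?C"
        using C.connected_if_awalk_spans[of u p v] apC by (auto simp: C.apath_def avC)
      fix b assume b: "b \<in> arcs G" "tail G b \<in> verts ?C \<or> head G b \<in> verts ?C"
      have sp: "set p \<subseteq> arcs G" using w by auto
      have "b \<in> set p" if "tail G b \<in> verts ?C"
      proof -
        have "tail G b \<in> insert v (tail G ` set p)"
          using that apath_verts_conv[OF p(1)] cas_insert_ends[of u p v] w by auto
        then show ?thesis
          using ends[OF b(1)] inj_on_image_mem_iff[OF inj_tail b(1) sp] by auto
      qed
      moreover have "b \<in> set p" if "head G b \<in> verts ?C"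
      proof -
        have "head G b \<noteq> u" using u(1) b(1) by blast
        then show ?thesis
          using that apath_verts_conv[OF p(1)] inj_on_image_mem_iff[OF inj_head b(1) sp] by simp
      qed
      ultimately show "b \<in> arcs ?C" using b by auto
    qed
    moreover have "is_nontrivial_dipath ?C"
      unfolding is_nontrivial_dipath_def using apC \<open>p \<noteq> []\<close> avC
      by (intro exI[of _ u] exI[of _ p] exI[of _ v]) auto
    moreover have "verts ?C \<inter> ?P = {u}"
      using start[OF calculation(1) apC \<open>p \<noteq> []\<close>] avC by simp
    ultimately show "X \<in> (\<lambda>C. verts C \<inter> ?P) ` ?CC"
      using u(2) by (intro image_eqI[of _ _ ?C]) auto
  qed
  have "inj_on (\<lambda>C. verts C \<inter> ?P) ?CC"
  proof (rule inj_onI)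
    fix C C' assume C: "C \<in> ?CC" "C' \<in> ?CC" and eq: "verts C \<inter> ?P = verts C' \<inter> ?P"
    have "verts C \<inter> ?P \<in> (\<lambda>u. {u}) ` ?P" using C im by blast
    then obtain u where "u \<in> verts C \<inter> ?P" by auto
    then show "C = C'" using components_eq_if_common_vertex[OF wf_digraph, of C C' u] C eq by blast
  qed
  from card_image[OF this] have "card ?CC = card ((\<lambda>u. {u}) ` ?P)" unfolding im by simp
  also have "\<dots> = card ?P" by (rule card_image) (auto intro: inj_onI)
  finally show ?thesis by (simp add: kp_def)
qed

end

section \<open>Counting cycles through atoms\<close>

text \<open>Atoms are determined by inclusion and the empty set alone, and \<open>f\<close> respects
  both.\<close>

lemma card_atoms_eq:
  assumes bij: "bij_betw f P Q"
    and mono: "\<And>A B. A \<in> P \<Longrightarrow> B \<in> P \<Longrightarrow> f A \<subseteq> f B \<longleftrightarrow> A \<subseteq> B"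
    and empty: "\<And>A. A \<in> P \<Longrightarrow> f A = {} \<longleftrightarrow> A = {}"
  shows "card (atoms P) = card (atoms Q)"
proof (rule bij_betw_same_card)
  have Q: "Q = f ` P" and inj: "inj_on f P" using bij by (auto simp: bij_betw_def)
  have iff: "A \<in> atoms P \<longleftrightarrow> f A \<in> atoms Q" if "A \<in> P" for A
    using that by (simp add: Q atoms_def mono empty inj_on_eq_iff[OF inj] cong: ball_cong)
  have "atoms P \<subseteq> P" "atoms Q \<subseteq> f ` P" by (auto simp: Q atoms_def)
  then have "f ` atoms P = atoms Q" using iff by blast
  then show "bij_betw f (atoms P) (atoms Q)"
    using inj by (auto simp: bij_betw_def atoms_def intro: inj_on_subset)
qed

lemma finite_cycs: "finite F \<Longrightarrow> finite (cycs t h F)"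
  by (rule finite_subset[of _ "Pow F"]) (auto simp: cycs_iff)

text \<open>Cycles are pairwise disjoint, so choosing one arc from each injects them into the arcs
  whose tail is also a head; path starts correspond to the remaining arcs.\<close>

lemma card_cycs_le:
  assumes "finite F" "inj_on t F" "inj_on h F"
  shows "card (cycs t h F) + card (t ` F - h ` F) \<le> card F"
proof -
  have disj: "A \<inter> B = {}" if "A \<in> cycs t h F" "B \<in> cycs t h F" "A \<noteq> B" for A B
  proof (rule ccontr)
    assume ne: "A \<inter> B \<noteq> {}"
    have A: "A \<subseteq> F" "B \<subseteq> F" "t ` A = h ` A" "t ` B = h ` B" using that by (auto simp: cycs_iff)
    \<comment> \<open>With injective end maps the intersection of balanced sets is balanced, so
      minimality forces equality.\<close>
    have "t ` (A \<inter> B) = h ` (A \<inter> B)"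
      using A assms inj_on_image_Int[of t F A B] inj_on_image_Int[of h F A B] by simp
    then have "A \<inter> B = A" "A \<inter> B = B" using that ne unfolding cycs_iff by (meson Int_lower1 Int_lower2)+
    then show False using that by auto
  qed
  define f where "f A = (SOME a. a \<in> A)" for A :: "'a set"
  have f: "f A \<in> A" if "A \<in> cycs t h F" for A
    using that unfolding f_def by (auto simp: cycs_iff some_in_eq)
  have "inj_on f (cycs t h F)"
  proof (rule inj_onI, rule ccontr)
    fix A B assume AB: "A \<in> cycs t h F" "B \<in> cycs t h F" "f A = f B" "A \<noteq> B"
    show False using f[OF AB(1)] f[OF AB(2)] disj[OF AB(1,2,4)] AB(3) by auto
  qed
  then have "card (cycs t h F) = card (f ` cycs t h F)" by (simp add: card_image)
  also have "\<dots> \<le> card {a \<in> F. t a \<in> h ` F}"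
  proof (rule card_mono)
    show "f ` cycs t h F \<subseteq> {a \<in> F. t a \<in> h ` F}"
    proof (rule image_subsetI)
      fix A assume A: "A \<in> cycs t h F"
      then have "A \<subseteq> F" "t ` A = h ` A" by (simp_all add: cycs_iff)
      then show "f A \<in> {a \<in> F. t a \<in> h ` F}" using f[OF A] by blast
    qed
  qed (use assms in auto)
  also have "t ` F - h ` F = t ` {a \<in> F. t a \<notin> h ` F}" by auto
  then have "card (t ` F - h ` F) = card {a \<in> F. t a \<notin> h ` F}"
    using assms(2) by (auto intro: card_image inj_on_subset)
  moreover have "card {a \<in> F. t a \<in> h ` F} + card {a \<in> F. t a \<notin> h ` F} = card F"
    using assms(1) by (subst card_Un_disjoint[symmetric]) (auto intro: arg_cong[where f = card])
  ultimately show ?thesis by linarith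
qed

section \<open>Contraction, extraction and weights\<close>

text \<open>
  Here \<open>F\<close> is a disjoint union of \<open>c\<close> cycles, \<open>p\<close> nontrivial paths (counted by their start vertices)
  and \<open>i\<close> isolated vertices. The weight \<open>x^i y^(|F|-c-p) (y+z)^c (z+xy)^p\<close> is the summand of the
  second claimed identity with denominators cleared, since \<open>|V| = i + |F| + p\<close>. The natural
  subtraction does not truncate, by \<open>card_cycs_le\<close>.
\<close>

definition cp_weight :: "'a::comm_semiring_1 \<Rightarrow> 'a \<Rightarrow> 'a \<Rightarrow> ('e \<Rightarrow> 'v) \<Rightarrow> ('e \<Rightarrow> 'v) \<Rightarrow> 'v set \<Rightarrow> 'e set \<Rightarrow> 'a" where
  "cp_weight x y z t h V F =
     x ^ card (V - (t ` F \<union> h ` F)) *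
     y ^ (card F - (card (cycs t h F) + card (t ` F - h ` F))) *
     (y + z) ^ card (cycs t h F) * (z + x * y) ^ card (t ` F - h ` F)"

lemma cp_weight_cong:
  assumes "card (V - (t ` F \<union> h ` F)) = card (V' - (t' ` F' \<union> h' ` F'))" "card F = card F'"
    "card (cycs t h F) = card (cycs t' h' F')" "card (t ` F - h ` F) = card (t' ` F' - h' ` F')"
  shows "cp_weight x y z t h V F = cp_weight x y z t' h' V' F'"
  using assms by (simp add: cp_weight_def)

text \<open>The singleton \<open>{e}\<close> is balanced, so it is the only minimal balanced set
  containing \<open>e\<close>.\<close>

lemma cycs_insert_loop:
  assumes "t e = h e" "e \<notin> F"
  shows "cycs t h (insert e F) = insert {e} (cycs t h F)"
proof (intro equalityI subsetI)
  fix A assume A: "A \<in> cycs t h (insert e F)"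
  show "A \<in> insert {e} (cycs t h F)"
  proof (cases "e \<in> A")
    case True
    moreover have "{e} \<subseteq> A \<longrightarrow> {e} \<noteq> {} \<longrightarrow> t ` {e} = h ` {e} \<longrightarrow> {e} = A"
      using A unfolding cycs_iff by blast
    ultimately have "{e} = A" using assms by simp
    then show ?thesis by auto
  next
    case False
    then show ?thesis using A by (simp add: cycs_iff subset_insert)
  qed
next
  fix A assume "A \<in> insert {e} (cycs t h F)"
  then consider "A = {e}" | "A \<in> cycs t h F" by auto
  then show "A \<in> cycs t h (insert e F)"
  proof cases
    case 1
    then show ?thesis using assms by (simp add: cycs_iff subset_singleton_iff)
  next
    case 2
    then show ?thesis by (simp add: cycs_iff subset_insertI2)
  qed
qed

text \<open>Injectivity keeps \<open>F\<close> away from the vertex of the loop. The loop adds one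
  arc and one cycle, which cancel in the exponent of \<open>y\<close>.\<close>

lemma cp_weight_loop:
  assumes "finite F" "t e = h e" "e \<notin> F" "inj_on t (insert e F)" "inj_on h (insert e F)"
  shows "cp_weight x y z t h V (insert e F) = (y + z) * cp_weight x y z t h (V - {t e}) F"
proof -
  have "{e} \<notin> cycs t h F" using assms(3) by (auto simp: cycs_iff)
  then have c: "card (cycs t h (insert e F)) = Suc (card (cycs t h F))"
    using assms by (simp add: cycs_insert_loop finite_cycs)
  have n: "t e \<notin> t ` F" "t e \<notin> h ` F" using assms by auto
  have "t ` insert e F - h ` insert e F = t ` F - h ` F"
    "V - (t ` insert e F \<union> h ` insert e F) = (V - {t e}) - (t ` F \<union> h ` F)"
    using n assms(2) by auto
  then show ?thesis
    unfolding cp_weight_def c using assms(1,3) by (simp add: mult_ac)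
qed

section \<open>Contracting a non-loop arc\<close>

locale proper_arc =
  fixes t h :: "'e \<Rightarrow> 'v" and e :: 'e
  assumes nonloop: "t e \<noteq> h e"
begin

definition merge :: "'v \<Rightarrow> 'v" where
  "merge w = (if w = h e then t e else w)"

text \<open>Since no tail equals \<open>t e\<close>, moving the tail \<open>h e\<close> there causes
  no collision.\<close>

lemma inj_on_merge_tail_iff:
  assumes "\<forall>a \<in> F. t a \<noteq> t e"
  shows "inj_on (merge \<circ> t) F \<longleftrightarrow> inj_on t F"
proof
  assume "inj_on t F"
  moreover have "inj_on merge (t ` F)"
    using assms by (auto simp: inj_on_def merge_def)
  ultimately show "inj_on (merge \<circ> t) F" by (rule comp_inj_on)
qed (rule inj_on_imageI2)

lemma inj_on_merge_head_iff:
  assumes "\<forall>a \<in> F. h a \<noteq> h e"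
  shows "inj_on (merge \<circ> h) F \<longleftrightarrow> inj_on h F"
  by (rule inj_on_cong) (use assms in \<open>auto simp: merge_def\<close>)

context
  fixes F
  assumes inj: "inj_on t (insert e F)" "inj_on h (insert e F)" and new: "e \<notin> F"
begin

lemma ends_neq: "a \<in> F \<Longrightarrow> t a \<noteq> t e" "a \<in> F \<Longrightarrow> h a \<noteq> h e"
  using inj_onD[OF inj(1), of a e] inj_onD[OF inj(2), of a e] new by auto

lemma image_merge_tail: "(merge \<circ> t) ` F = (if h e \<in> t ` F then insert (t e) (t ` F - {h e}) else t ` F)"
  by (force simp: merge_def)

lemma image_merge_head: "(merge \<circ> h) ` F = h ` F"
  by (rule image_cong) (use ends_neq in \<open>auto simp: merge_def\<close>)

text \<open>Deleting \<open>e\<close> maps balanced sets bijectively to balanced sets of the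
  contraction: a cycle through \<open>e\<close> becomes shorter by one arc but stays nonempty, as
  \<open>e\<close> is not a loop.\<close>

lemma card_cycs_contract: "card (cycs t h (insert e F)) = card (cycs (merge \<circ> t) (merge \<circ> h) F)"
proof (rule card_atoms_eq)
  let ?P = "balanced t h (insert e F)" and ?Q = "balanced (merge \<circ> t) (merge \<circ> h) F"
  have P: "e \<in> A \<longleftrightarrow> t e \<in> t ` A" "e \<in> A \<longleftrightarrow> h e \<in> t ` A" "e \<in> A \<longleftrightarrow> h e \<in> h ` A"
      "t ` A = h ` A" "A \<subseteq> insert e F"
    if "A \<in> ?P" for A
    using that inj_on_image_mem_iff[OF inj(1), of e A] inj_on_image_mem_iff[OF inj(2), of e A]
    by (auto simp: balanced_def)
  show mono: "A - {e} \<subseteq> B - {e} \<longleftrightarrow> A \<subseteq> B" if AB: "A \<in> ?P" "B \<in> ?P" for A B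
  proof
    assume sub: "A - {e} \<subseteq> B - {e}"
    have "e \<in> B" if "e \<in> A"
    proof -
      \<comment> \<open>The successor \<open>b\<close> of \<open>e\<close> differs from
        \<open>e\<close> and so survives in \<open>B\<close>; by balance its presence forces
        \<open>e\<close> into \<open>B\<close>.\<close>
      from that obtain b where b: "b \<in> A" "t b = h e" using P(2)[OF AB(1)] by auto
      then have "b \<in> B" using sub nonloop by auto
      then show ?thesis using b P(2)[OF AB(2)] by (metis imageI)
    qed
    then show "A \<subseteq> B" using sub by auto
  qed auto
  show "A - {e} = {} \<longleftrightarrow> A = {}" if "A \<in> ?P" for A
    using mono[OF that, of "{}"] by (auto simp: balanced_def)
  show "bij_betw (\<lambda>A. A - {e}) ?P ?Q"
    unfolding bij_betw_def
  proof (intro conjI equalityI subsetI)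
    show "inj_on (\<lambda>A. A - {e}) ?P"
      by (rule inj_onI) (metis mono order_antisym order_refl)
    fix B
    {
      assume "B \<in> (\<lambda>A. A - {e}) ` ?P"
      then obtain A where A: "A \<in> ?P" "B = A - {e}" by auto
      note PA = P[OF A(1)]
      have "B \<subseteq> F" using PA A by auto
      have tB: "t ` B = t ` A - {t e}" "h ` B = h ` A - {h e}"
        using A(2) inj_on_image_set_diff[OF inj(1) _ , of A "{e}"] inj_on_image_set_diff[OF inj(2) _ , of A "{e}"] PA(1,3,5)
        by (auto simp del: inj_on_insert)
      have "(merge \<circ> t) ` B = (merge \<circ> h) ` B"
        unfolding image_comp[symmetric] tB PA(4)[symmetric]
        using PA(1,2) nonloop by (cases "e \<in> A") (auto simp: merge_def)
      then show "B \<in> ?Q" using \<open>B \<subseteq> F\<close> by (auto simp: balanced_def)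
    next
      assume "B \<in> ?Q"
      then have B: "B \<subseteq> F" and eq: "(merge \<circ> t) ` B = (merge \<circ> h) ` B" by (auto simp: balanced_def)
      have "(merge \<circ> h) ` B = h ` B"
        by (rule image_cong) (use ends_neq B in \<open>auto simp: merge_def\<close>)
      then have hB: "h ` B = merge ` (t ` B)" using eq by (simp add: image_comp)
      \<comment> \<open>The arc \<open>e\<close> is restored exactly when \<open>B\<close> continues
        from its head.\<close>
      let ?A = "if h e \<in> t ` B then insert e B else B"
      have "merge ` (t ` B) = (if h e \<in> t ` B then insert (t e) (t ` B - {h e}) else t ` B)"
        by (force simp: merge_def)
      then have "t ` ?A = h ` ?A" using hB by auto
      moreover have "?A \<subseteq> insert e F" using B by auto
      ultimately have "?A \<in> ?P" by (auto simp: balanced_def)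
      moreover have "B = ?A - {e}" using B new by auto
      ultimately show "B \<in> (\<lambda>A. A - {e}) ` ?P" by (rule rev_image_eqI)
    }
  qed
qed

text \<open>By \<open>touch\<close> the arc is not a path component of its own, so contraction
  preserves the numbers of cycles, path starts and isolated vertices and loses just one arc.\<close>

lemma cp_weight_contract:
  assumes fin: "finite F" and V: "t e \<in> V" "h e \<in> V"
    and touch: "t e \<in> h ` F \<or> h e \<in> t ` F"
  shows "cp_weight x y z t h V (insert e F) = y * cp_weight x y z (merge \<circ> t) (merge \<circ> h) (V - {h e}) F"
proof -
  have n: "t e \<notin> t ` F" "h e \<notin> h ` F" unfolding image_iff using ends_neq by metis+
  have p: "t ` insert e F - h ` insert e F = (merge \<circ> t) ` F - (merge \<circ> h) ` F"
    unfolding image_merge_head image_merge_tail using n nonloop touch by (auto split: if_splits)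
  have i: "V - (t ` insert e F \<union> h ` insert e F) = V - {h e} - ((merge \<circ> t) ` F \<union> (merge \<circ> h) ` F)"
    unfolding image_merge_head image_merge_tail using n nonloop touch by (auto split: if_splits)
  have "inj_on (merge \<circ> t) F" "inj_on (merge \<circ> h) F"
    using inj ends_neq by (auto simp: inj_on_def merge_def)
  \<comment> \<open>This bound lets the successor move out of the natural subtraction in the
    exponent of \<open>y\<close>.\<close>
  from card_cycs_le[OF fin this]
  show ?thesis
    unfolding cp_weight_def card_cycs_contract p i using fin new by (simp add: Suc_diff_le mult_ac)
qed

text \<open>Here \<open>e\<close> forms a path component by itself. Keeping it adds one path and
  leaves the exponent of \<open>y\<close> unchanged; contracting it leaves one additional isolated
  vertex.\<close>

lemma cp_weight_isolated:
  assumes fin: "finite F" "finite V" and V: "t e \<in> V" "h e \<in> V"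
    and iso: "t e \<notin> h ` F" "h e \<notin> t ` F"
  shows "cp_weight x y z t h V (insert e F) = (z + x * y) * cp_weight x y z t h (V - {t e, h e}) F"
    and "cp_weight x y z (merge \<circ> t) (merge \<circ> h) (V - {h e}) F = x * cp_weight x y z t h (V - {t e, h e}) F"
proof -
  have n: "t e \<notin> t ` F" "h e \<notin> h ` F" unfolding image_iff using ends_neq by metis+
  have "t a \<noteq> h e" "h a \<noteq> h e" if "a \<in> F" for a
    using that iso n by (metis imageI)+
  then have same: "(merge \<circ> t) ` A = t ` A" "(merge \<circ> h) ` A = h ` A" if "A \<subseteq> F" for A
    using that by (auto simp: merge_def subset_iff intro!: image_cong)
  have bal: "balanced (merge \<circ> t) (merge \<circ> h) F = balanced t h F"
    unfolding balanced_def by (intro Collect_cong conj_cong refl) (simp only: same)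
  have c: "card (cycs t h (insert e F)) = card (cycs t h F)"
    using card_cycs_contract bal by simp
  have "t ` insert e F - h ` insert e F = insert (t e) (t ` F - h ` F)"
    using n iso nonloop by auto
  then have p: "card (t ` insert e F - h ` insert e F) = Suc (card (t ` F - h ` F))"
    using n fin by auto
  have i: "V - (t ` insert e F \<union> h ` insert e F) = V - {t e, h e} - (t ` F \<union> h ` F)" by auto
  show "cp_weight x y z t h V (insert e F) = (z + x * y) * cp_weight x y z t h (V - {t e, h e}) F"
    unfolding cp_weight_def c p i using fin new by (simp add: mult_ac)
  have "V - {h e} - (t ` F \<union> h ` F) = insert (t e) (V - {t e, h e} - (t ` F \<union> h ` F))"
    using V iso n nonloop by auto
  then have "card (V - {h e} - (t ` F \<union> h ` F)) = Suc (card (V - {t e, h e} - (t ` F \<union> h ` F)))"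
    using fin by auto
  then show "cp_weight x y z (merge \<circ> t) (merge \<circ> h) (V - {h e}) F = x * cp_weight x y z t h (V - {t e, h e}) F"
    unfolding cp_weight_def bal same[OF order_refl] by (simp add: mult_ac)
qed

end

end

definition partial_injs :: "('e \<Rightarrow> 'v) \<Rightarrow> ('e \<Rightarrow> 'v) \<Rightarrow> 'e set \<Rightarrow> 'e set set" where
  "partial_injs t h E = {F. F \<subseteq> E \<and> inj_on t F \<and> inj_on h F}"

lemma finite_partial_injs: "finite E \<Longrightarrow> finite (partial_injs t h E)"
  by (rule finite_subset[of _ "Pow E"]) (auto simp: partial_injs_def)

section \<open>An explicit arc elimination invariant\<close>

text \<open>This is the sum \<Xi>(D). Arbitrary semiring arguments allow the same expression to
  serve as the polynomial and as its values.\<close>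

definition cp_sum :: "'a::comm_semiring_1 \<Rightarrow> 'a \<Rightarrow> 'a \<Rightarrow> ('v, 'e) pre_digraph \<Rightarrow> 'a" where
  "cp_sum x y z D = (\<Sum>F \<in> partial_injs (tail D) (head D) (arcs D).
     cp_weight x y z (tail D) (head D) (verts D) F)"

lemma sum_partial_injs_split:
  assumes "finite E" "e \<in> E"
  shows "sum w (partial_injs t h E) = sum w (partial_injs t h (E - {e})) +
    (\<Sum>F \<in> {F. F \<subseteq> E - {e} \<and> inj_on t (insert e F) \<and> inj_on h (insert e F)}. w (insert e F))"
    (is "_ = _ + sum _ ?G")
proof -
  have "partial_injs t h E = partial_injs t h (E - {e}) \<union> insert e ` ?G"
  proof (intro equalityI subsetI)
    fix F assume F: "F \<in> partial_injs t h E"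
    show "F \<in> partial_injs t h (E - {e}) \<union> insert e ` ?G"
    proof (cases "e \<in> F")
      case True
      then have "F = insert e (F - {e})" by auto
      moreover from this have "F - {e} \<in> ?G" using F True by (auto simp: partial_injs_def insert_absorb simp del: inj_on_insert)
      ultimately show ?thesis by blast
    qed (use F in \<open>auto simp: partial_injs_def\<close>)
  qed (use assms in \<open>auto simp: partial_injs_def\<close>)
  moreover have "sum w (partial_injs t h (E - {e}) \<union> insert e ` ?G) =
    sum w (partial_injs t h (E - {e})) + sum w (insert e ` ?G)"
    using assms by (intro sum.union_disjoint finite_partial_injs finite_imageI)
      (auto simp: partial_injs_def)
  moreover have "sum w (insert e ` ?G) = (\<Sum>F \<in> ?G. w (insert e F))"
    by (subst sum.reindex) (auto simp: inj_on_def)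
  ultimately show ?thesis by simp
qed

text \<open>The family \<open>?G\<close> of sets extendable by \<open>e\<close> is exactly the
  family summed over for the contraction; for a non-loop, the sets in it that avoid both ends of
  \<open>e\<close> are those summed over for the extraction.\<close>

lemma cp_sum_deletion_contraction:
  assumes "fin_digraph D" and e: "e \<in> arcs D"
  shows "cp_sum x y z D = cp_sum x y z (pre_digraph.del_arc D e) + y * cp_sum x y z (contract_arc D e)
    + z * cp_sum x y z (extract_arc D e)"
proof -
  interpret fin_digraph D by fact
  let ?t = "tail D" and ?h = "head D" and ?E = "arcs D" and ?V = "verts D"
  let ?G = "{F. F \<subseteq> ?E - {e} \<and> inj_on ?t (insert e F) \<and> inj_on ?h (insert e F)}"
  have finE: "finite ?E" and fin: "finite F" if "F \<in> ?G" for F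
    using that finite_subset[of F ?E] by auto
  have "cp_sum x y z D = cp_sum x y z (del_arc e) + (\<Sum>F \<in> ?G. cp_weight x y z ?t ?h ?V (insert e F))"
    unfolding cp_sum_def using sum_partial_injs_split[OF finite_arcs e] by simp
  also have "(\<Sum>F \<in> ?G. cp_weight x y z ?t ?h ?V (insert e F)) =
    y * cp_sum x y z (contract_arc D e) + z * cp_sum x y z (extract_arc D e)"
  proof (cases "?t e = ?h e")
    case True
    have C: "contract_arc D e = del_vert (?t e)" using True by (simp add: contract_arc_def)
    \<comment> \<open>For a loop, contraction and extraction coincide, which matches the factor
      \<open>y + z\<close>.\<close>
    have X: "extract_arc D e = del_vert (?t e)"
      using True by (auto simp: extract_arc_def pre_digraph.del_vert_def)
    have G: "?G = partial_injs ?t ?h (arcs (del_vert (?t e)))"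
    proof (intro equalityI subsetI)
      fix F assume F: "F \<in> ?G"
      have "?t a \<noteq> ?t e \<and> ?h a \<noteq> ?t e" if "a \<in> F" for a
        using F that True inj_onD[of ?t "insert e F" a e] inj_onD[of ?h "insert e F" a e]
        by (auto simp del: inj_on_insert)
      then show "F \<in> partial_injs ?t ?h (arcs (del_vert (?t e)))"
        using F by (auto simp: partial_injs_def del_vert_simps)
    qed (use True e in \<open>auto simp: partial_injs_def del_vert_simps\<close>)
    have "(\<Sum>F \<in> ?G. cp_weight x y z ?t ?h ?V (insert e F)) =
      (\<Sum>F \<in> ?G. (y + z) * cp_weight x y z ?t ?h (?V - {?t e}) F)"
    proof (rule sum.cong[OF refl])
      fix F assume F: "F \<in> ?G"
      then have "e \<notin> F" "inj_on ?t (insert e F)" "inj_on ?h (insert e F)" by blast+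
      then show "cp_weight x y z ?t ?h ?V (insert e F) = (y + z) * cp_weight x y z ?t ?h (?V - {?t e}) F"
        using fin[OF F] True by (intro cp_weight_loop)
    qed
    then show ?thesis
      unfolding C X cp_sum_def G by (simp add: del_vert_simps sum_distrib_left algebra_simps sum.distrib)
  next
    case False
    interpret proper_arc ?t ?h e by standard (rule False)
    let ?C = "contract_arc D e"
    have C: "verts ?C = ?V - {?h e}" "arcs ?C = {a \<in> ?E. ?t a \<noteq> ?t e \<and> ?h a \<noteq> ?h e}"
      "tail ?C = merge \<circ> ?t" "head ?C = merge \<circ> ?h"
      using False e by (auto simp: contract_arc_def merge_def Let_def fun_eq_iff)
    have X: "verts (extract_arc D e) = ?V - {?t e, ?h e}"
      "arcs (extract_arc D e) = {a \<in> ?E. ?t a \<notin> {?t e, ?h e} \<and> ?h a \<notin> {?t e, ?h e}}"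
      "tail (extract_arc D e) = ?t" "head (extract_arc D e) = ?h"
      by (auto simp: extract_arc_def pre_digraph.del_vert_def)
    have neq: "?t a \<noteq> ?t e \<and> ?h a \<noteq> ?h e" if "F \<in> ?G" "a \<in> F" for F a
      using that inj_onD[of ?t "insert e F" a e] inj_onD[of ?h "insert e F" a e]
      by (auto simp del: inj_on_insert)
    have G: "?G = partial_injs (merge \<circ> ?t) (merge \<circ> ?h) (arcs ?C)"
    proof (intro equalityI subsetI)
      fix F assume F: "F \<in> ?G"
      then show "F \<in> partial_injs (merge \<circ> ?t) (merge \<circ> ?h) (arcs ?C)"
        using neq[OF F] by (auto simp: C partial_injs_def inj_on_merge_tail_iff inj_on_merge_head_iff)
    next
      fix F assume F: "F \<in> partial_injs (merge \<circ> ?t) (merge \<circ> ?h) (arcs ?C)"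
      then have sub: "F \<subseteq> {a \<in> ?E. ?t a \<noteq> ?t e \<and> ?h a \<noteq> ?h e}" by (simp add: partial_injs_def C)
      then have "inj_on ?t F" "inj_on ?h F"
        using F inj_on_merge_tail_iff[of F] inj_on_merge_head_iff[of F] by (auto simp: partial_injs_def)
      then show "F \<in> ?G" using sub by fastforce
    qed
    \<comment> \<open>The sets for which \<open>e\<close> becomes a path component of its own; only
      these contribute a \<open>z\<close> term.\<close>
    let ?I = "{F \<in> ?G. ?t e \<notin> ?h ` F \<and> ?h e \<notin> ?t ` F}"
    have I: "?I = partial_injs ?t ?h (arcs (extract_arc D e))"
    proof (intro equalityI subsetI)
      fix F assume "F \<in> ?I"
      then have F: "F \<in> ?G" and I: "?t e \<notin> ?h ` F" "?h e \<notin> ?t ` F" by auto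
      have "F \<subseteq> arcs (extract_arc D e)"
      proof
        fix a assume a: "a \<in> F"
        have "?t a \<noteq> ?h e" "?h a \<noteq> ?t e" using I a by (metis imageI)+
        then show "a \<in> arcs (extract_arc D e)" using neq[OF F a] F a unfolding X by auto
      qed
      then show "F \<in> partial_injs ?t ?h (arcs (extract_arc D e))"
        using F by (auto simp: partial_injs_def)
    qed (auto simp: X partial_injs_def image_iff)
    have finG: "finite ?G" by (rule finite_subset[of _ "Pow ?E"]) auto
    have "cp_weight x y z ?t ?h ?V (insert e F) = y * cp_weight x y z (merge \<circ> ?t) (merge \<circ> ?h) (?V - {?h e}) F
      + (if F \<in> ?I then z * cp_weight x y z ?t ?h (?V - {?t e, ?h e}) F else 0)" if F: "F \<in> ?G" for F
    proof -
      have i: "inj_on ?t (insert e F)" "inj_on ?h (insert e F)" "e \<notin> F" "?t e \<in> ?V" "?h e \<in> ?V"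
        using F e by (auto simp del: inj_on_insert)
      show ?thesis
      proof (cases "F \<in> ?I")
        case True
        then have "?t e \<notin> ?h ` F" "?h e \<notin> ?t ` F" by auto
        note w = cp_weight_isolated[OF i(1-3) fin[OF F] finite_verts i(4,5) this]
        show ?thesis unfolding w using True by (simp add: algebra_simps)
      next
        case False
        then show ?thesis
          using cp_weight_contract[OF i(1-3) fin[OF F] i(4,5)] F by auto
      qed
    qed
    then have "(\<Sum>F \<in> ?G. cp_weight x y z ?t ?h ?V (insert e F)) =
      (\<Sum>F \<in> ?G. y * cp_weight x y z (merge \<circ> ?t) (merge \<circ> ?h) (?V - {?h e}) F
      + (if F \<in> ?I then z * cp_weight x y z ?t ?h (?V - {?t e, ?h e}) F else 0))"
      by (intro sum.cong refl)
    also have "\<dots> = (\<Sum>F \<in> ?G. y * cp_weight x y z (merge \<circ> ?t) (merge \<circ> ?h) (?V - {?h e}) F)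
      + (\<Sum>F \<in> ?I. z * cp_weight x y z ?t ?h (?V - {?t e, ?h e}) F)"
      unfolding sum.distrib sum.inter_filter[OF finG, symmetric]
      by (intro arg_cong2[where f = "(+)"] sum.cong) auto
    also have "\<dots> = y * cp_sum x y z ?C + z * cp_sum x y z (extract_arc D e)"
      unfolding I unfolding cp_sum_def G C(1,3,4) X(1,3,4) sum_distrib_left ..
    finally show ?thesis .
  qed
  finally show ?thesis by (simp add: add.assoc)
qed

section \<open>Isomorphism invariance\<close>

text \<open>The weight depends only on cardinalities, which the vertex and arc bijections preserve.
  The end maps are compared on sets of arcs only, where the isomorphism controls them.\<close>

lemma cp_sum_iso:
  assumes "digraph_iso D D'" "fin_digraph D"
  shows "cp_sum x y z D = cp_sum x y z D'"
proof -
  interpret fin_digraph D by fact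
  obtain \<phi> where iso: "digraph_isomorphism \<phi>" and D': "D' = app_iso \<phi> D"
    using assms by (auto simp: digraph_iso_def)
  let ?f = "iso_arcs \<phi>" and ?g = "iso_verts \<phi>"
  have f: "inj_on ?f (arcs D)" and g: "inj_on ?g (verts D)"
    and ends: "\<And>a. a \<in> arcs D \<Longrightarrow> iso_tail \<phi> (?f a) = ?g (tail D a)" "\<And>a. a \<in> arcs D \<Longrightarrow> iso_head \<phi> (?f a) = ?g (head D a)"
    using iso by (auto simp: digraph_isomorphism_def)
  have im: "iso_tail \<phi> ` ?f ` A = ?g ` tail D ` A" "iso_head \<phi> ` ?f ` A = ?g ` head D ` A" if "A \<subseteq> arcs D" for A
    using that ends by (auto simp: image_image intro!: image_cong)
  have sub: "tail D ` A \<subseteq> verts D" "head D ` A \<subseteq> verts D" if "A \<subseteq> arcs D" for A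
    using that by auto
  have inj: "inj_on (iso_tail \<phi>) (?f ` A) \<longleftrightarrow> inj_on (tail D) A" "inj_on (iso_head \<phi>) (?f ` A) \<longleftrightarrow> inj_on (head D) A"
    if "A \<subseteq> arcs D" for A
  proof -
    have "inj_on ?f A" using f that inj_on_subset by auto
    then show "inj_on (iso_tail \<phi>) (?f ` A) \<longleftrightarrow> inj_on (tail D) A" "inj_on (iso_head \<phi>) (?f ` A) \<longleftrightarrow> inj_on (head D) A"
      using that ends inj_on_eq_iff[OF f] inj_on_eq_iff[OF g] by (auto simp: inj_on_def subset_iff)
  qed
  have weight: "cp_weight x y z (iso_tail \<phi>) (iso_head \<phi>) (?g ` verts D) (?f ` F) =
    cp_weight x y z (tail D) (head D) (verts D) F" if F: "F \<subseteq> arcs D" for F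
  proof (rule cp_weight_cong)
    note s = sub[OF F]
    have "?g ` verts D - (iso_tail \<phi> ` ?f ` F \<union> iso_head \<phi> ` ?f ` F) = ?g ` (verts D - (tail D ` F \<union> head D ` F))"
      unfolding im[OF F] using s inj_on_image_set_diff[OF g, of "verts D" "tail D ` F \<union> head D ` F"]
      by (auto simp: image_Un)
    then show "card (?g ` verts D - (iso_tail \<phi> ` ?f ` F \<union> iso_head \<phi> ` ?f ` F)) = card (verts D - (tail D ` F \<union> head D ` F))"
      using g by (metis Diff_subset card_image inj_on_subset)
    show "card (?f ` F) = card F" using f F by (metis card_image inj_on_subset)
    have "iso_tail \<phi> ` ?f ` F - iso_head \<phi> ` ?f ` F = ?g ` (tail D ` F - head D ` F)"
      unfolding im[OF F] using s inj_on_image_set_diff[OF g, of "tail D ` F" "head D ` F"] by auto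
    then show "card (iso_tail \<phi> ` ?f ` F - iso_head \<phi> ` ?f ` F) = card (tail D ` F - head D ` F)"
      using g s by (metis Diff_subset card_image inj_on_subset)
    have iff: "A \<in> balanced (tail D) (head D) F \<longleftrightarrow> ?f ` A \<in> balanced (iso_tail \<phi>) (iso_head \<phi>) (?f ` F)" if "A \<subseteq> F" for A
    proof -
      have A: "A \<subseteq> arcs D" using that F by auto
      show ?thesis
        unfolding balanced_def mem_Collect_eq im[OF A] inj_on_image_eq_iff[OF g sub[OF A]] using that by auto
    qed
    show "card (cycs (iso_tail \<phi>) (iso_head \<phi>) (?f ` F)) = card (cycs (tail D) (head D) F)"
    proof (rule card_atoms_eq[symmetric])
      show "bij_betw ((`) ?f) (balanced (tail D) (head D) F) (balanced (iso_tail \<phi>) (iso_head \<phi>) (?f ` F))"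
        unfolding bij_betw_def
      proof (intro conjI equalityI subsetI)
        show "inj_on ((`) ?f) (balanced (tail D) (head D) F)"
          by (rule inj_on_subset[OF inj_on_image_Pow[OF f]]) (use F in \<open>auto simp: balanced_def\<close>)
        fix B
        {
          assume "B \<in> (`) ?f ` balanced (tail D) (head D) F"
          then obtain A where A: "A \<in> balanced (tail D) (head D) F" "B = ?f ` A" by auto
          then have "A \<subseteq> F" by (simp add: balanced_def)
          then show "B \<in> balanced (iso_tail \<phi>) (iso_head \<phi>) (?f ` F)"
            using iff A by simp
        next
          assume B: "B \<in> balanced (iso_tail \<phi>) (iso_head \<phi>) (?f ` F)"
          then have "B \<subseteq> ?f ` F" by (auto simp: balanced_def)
          then obtain A where "A \<subseteq> F" "B = ?f ` A" by (auto simp: subset_image_iff)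
          then show "B \<in> (`) ?f ` balanced (tail D) (head D) F" using iff B by auto
        }
      qed
      show "?f ` A \<subseteq> ?f ` B \<longleftrightarrow> A \<subseteq> B" if "A \<in> balanced (tail D) (head D) F" "B \<in> balanced (tail D) (head D) F" for A B
      proof -
        have "A \<subseteq> arcs D" "B \<subseteq> arcs D" using that F by (auto simp: balanced_def)
        then show ?thesis using inj_on_image_mem_iff[OF f, of _ B] by blast
      qed
    qed auto
  qed
  have P: "partial_injs (iso_tail \<phi>) (iso_head \<phi>) (?f ` arcs D) = (`) ?f ` partial_injs (tail D) (head D) (arcs D)"
  proof (intro equalityI subsetI)
    fix B assume B: "B \<in> partial_injs (iso_tail \<phi>) (iso_head \<phi>) (?f ` arcs D)"
    then have "B \<subseteq> ?f ` arcs D" by (auto simp: partial_injs_def)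
    then obtain A where "A \<subseteq> arcs D" "B = ?f ` A" by (auto simp: subset_image_iff)
    then show "B \<in> (`) ?f ` partial_injs (tail D) (head D) (arcs D)"
      using B inj by (auto simp: partial_injs_def)
  qed (use inj in \<open>auto simp: partial_injs_def\<close>)
  have "inj_on ((`) ?f) (partial_injs (tail D) (head D) (arcs D))"
    by (rule inj_on_subset[OF inj_on_image_Pow[OF f]]) (auto simp: partial_injs_def)
  then show ?thesis
    unfolding D' cp_sum_def app_iso_simps P
    by (subst sum.reindex) (auto intro!: sum.cong weight[symmetric] simp: partial_injs_def)
qed

section \<open>Multiplicativity and arcless digraphs\<close>

text \<open>A balanced set splits into balanced parts on the two sides, so a minimal one lies on a
  single side.\<close>

lemma cycs_disjoint_union:
  assumes disj: "(t ` F1 \<union> h ` F1) \<inter> (t ` F2 \<union> h ` F2) = {}"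
  shows "cycs t h (F1 \<union> F2) = cycs t h F1 \<union> cycs t h F2"
proof (intro equalityI subsetI)
  fix A assume A: "A \<in> cycs t h (F1 \<union> F2)"
  then have sub: "A \<subseteq> F1 \<union> F2" and ne: "A \<noteq> {}" and bal: "t ` A = h ` A"
    and min: "\<And>B. B \<subseteq> A \<Longrightarrow> B \<noteq> {} \<Longrightarrow> t ` B = h ` B \<Longrightarrow> B = A"
    by (simp_all add: cycs_iff)
  have *: "k ` (A \<inter> F) = k ` A \<inter> X" if "A \<subseteq> F \<union> G" "k ` F \<subseteq> X" "k ` G \<inter> X = {}"
    for k F G X
    using that by blast
  have part: "t ` (A \<inter> F) = h ` (A \<inter> F)"
    if "A \<subseteq> F \<union> G" "(t ` F \<union> h ` F) \<inter> (t ` G \<union> h ` G) = {}" for F G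
  proof -
    have "t ` G \<inter> (t ` F \<union> h ` F) = {}" "h ` G \<inter> (t ` F \<union> h ` F) = {}" using that(2) by blast+
    then show ?thesis using *[OF that(1), of t "t ` F \<union> h ` F"] *[OF that(1), of h "t ` F \<union> h ` F"] bal by simp
  qed
  have "t ` (A \<inter> F1) = h ` (A \<inter> F1)" by (rule part[OF sub disj])
  then have "A \<inter> F1 = {} \<or> A \<inter> F1 = A" using min[of "A \<inter> F1"] by auto
  then have "A \<subseteq> F1 \<or> A \<subseteq> F2" using sub by auto
  then show "A \<in> cycs t h F1 \<union> cycs t h F2" using A by (auto simp: cycs_iff)
qed (auto simp: cycs_iff)

text \<open>All four exponents are additive; for the one with natural subtraction this rests on
  \<open>card_cycs_le\<close> on each side.\<close>

lemma cp_weight_disjoint_union: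
  assumes fin: "finite V1" "finite V2" "finite F1" "finite F2" and disj: "V1 \<inter> V2 = {}"
    and V1: "t ` F1 \<union> h ` F1 \<subseteq> V1" and V2: "t ` F2 \<union> h ` F2 \<subseteq> V2"
    and inj: "inj_on t F1" "inj_on t F2" "inj_on h F1" "inj_on h F2"
  shows "cp_weight x y z t h (V1 \<union> V2) (F1 \<union> F2) = cp_weight x y z t h V1 F1 * cp_weight x y z t h V2 F2"
proof -
  have F: "F1 \<inter> F2 = {}" using V1 V2 disj by fastforce
  have "cycs t h F1 \<inter> cycs t h F2 = {}"
  proof (rule equals0I)
    fix A assume "A \<in> cycs t h F1 \<inter> cycs t h F2"
    then have "A \<subseteq> F1" "A \<subseteq> F2" "A \<noteq> {}" by (simp_all add: cycs_iff)
    then show False using F by blast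
  qed
  moreover have "cycs t h (F1 \<union> F2) = cycs t h F1 \<union> cycs t h F2"
    by (rule cycs_disjoint_union) (use V1 V2 disj in blast)
  ultimately have c: "card (cycs t h (F1 \<union> F2)) = card (cycs t h F1) + card (cycs t h F2)"
    using fin by (simp add: card_Un_disjoint finite_cycs)
  have "t ` (F1 \<union> F2) - h ` (F1 \<union> F2) = (t ` F1 - h ` F1) \<union> (t ` F2 - h ` F2)"
    using V1 V2 disj by fast
  moreover have "(t ` F1 - h ` F1) \<inter> (t ` F2 - h ` F2) = {}" using V1 V2 disj by blast
  ultimately have p: "card (t ` (F1 \<union> F2) - h ` (F1 \<union> F2)) = card (t ` F1 - h ` F1) + card (t ` F2 - h ` F2)"
    using fin by (simp add: card_Un_disjoint)
  have "(V1 \<union> V2) - (t ` (F1 \<union> F2) \<union> h ` (F1 \<union> F2)) = (V1 - (t ` F1 \<union> h ` F1)) \<union> (V2 - (t ` F2 \<union> h ` F2))"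
    using V1 V2 disj by fast
  moreover have "(V1 - (t ` F1 \<union> h ` F1)) \<inter> (V2 - (t ` F2 \<union> h ` F2)) = {}" using disj by blast
  ultimately have i: "card ((V1 \<union> V2) - (t ` (F1 \<union> F2) \<union> h ` (F1 \<union> F2))) = card (V1 - (t ` F1 \<union> h ` F1)) + card (V2 - (t ` F2 \<union> h ` F2))"
    using fin by (simp add: card_Un_disjoint)
  have f: "card (F1 \<union> F2) = card F1 + card F2" using fin F by (rule_tac card_Un_disjoint)
  have "card (F1 \<union> F2) - (card (cycs t h (F1 \<union> F2)) + card (t ` (F1 \<union> F2) - h ` (F1 \<union> F2))) =
    (card F1 - (card (cycs t h F1) + card (t ` F1 - h ` F1))) + (card F2 - (card (cycs t h F2) + card (t ` F2 - h ` F2)))"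
    unfolding f c p using card_cycs_le[OF fin(3) inj(1,3)] card_cycs_le[OF fin(4) inj(2,4)] by linarith
  then show ?thesis
    unfolding cp_weight_def unfolding i c p by (simp add: power_add mult_ac)
qed

text \<open>Intersecting with the two disjoint arc sets inverts the union of pairs, so the sum
  factors.\<close>

lemma cp_sum_union:
  assumes "fin_digraph D1" "fin_digraph D2" "compatible D1 D2" and disj: "verts D1 \<inter> verts D2 = {}"
  shows "cp_sum x y z (Digraph_Component.union D1 D2) = cp_sum x y z D1 * cp_sum x y z D2"
proof -
  interpret D1: fin_digraph D1 by fact
  interpret D2: fin_digraph D2 by fact
  let ?t = "tail D1" and ?h = "head D1"
  have eq: "tail D2 = ?t" "head D2 = ?h" using assms(3) by (auto simp: compatible_def)
  have V1: "?t ` F \<union> ?h ` F \<subseteq> verts D1" if "F \<subseteq> arcs D1" for F using that by auto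
  have V2: "?t ` F \<union> ?h ` F \<subseteq> verts D2" if "F \<subseteq> arcs D2" for F
    using that D2.wellformed unfolding eq by auto
  have E: "arcs D1 \<inter> arcs D2 = {}" using V1[of "arcs D1"] V2[of "arcs D2"] disj by fastforce
  let ?P1 = "partial_injs ?t ?h (arcs D1)" and ?P2 = "partial_injs ?t ?h (arcs D2)"
  have "bij_betw (\<lambda>(F1, F2). F1 \<union> F2) (?P1 \<times> ?P2) (partial_injs ?t ?h (arcs D1 \<union> arcs D2))"
    unfolding bij_betw_def
  proof (intro conjI equalityI subsetI)
    show "inj_on (\<lambda>(F1, F2). F1 \<union> F2) (?P1 \<times> ?P2)"
      by (rule inj_on_inverseI[where g = "\<lambda>F. (F \<inter> arcs D1, F \<inter> arcs D2)"])
        (use E in \<open>auto simp: partial_injs_def\<close>)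
    fix F
    {
      assume "F \<in> (\<lambda>(F1, F2). F1 \<union> F2) ` (?P1 \<times> ?P2)"
      then obtain F1 F2 where F: "F = F1 \<union> F2" "F1 \<in> ?P1" "F2 \<in> ?P2" by auto
      then have "?t ` F1 \<inter> ?t ` F2 = {}" "?h ` F1 \<inter> ?h ` F2 = {}"
        using V1[of F1] V2[of F2] disj unfolding partial_injs_def by blast+
      then show "F \<in> partial_injs ?t ?h (arcs D1 \<union> arcs D2)"
        using F by (auto simp: partial_injs_def inj_on_Un)
    next
      assume "F \<in> partial_injs ?t ?h (arcs D1 \<union> arcs D2)"
      then have "F \<inter> arcs D1 \<in> ?P1" "F \<inter> arcs D2 \<in> ?P2" "F = F \<inter> arcs D1 \<union> F \<inter> arcs D2"
        by (auto simp: partial_injs_def intro: inj_on_subset)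
      then show "F \<in> (\<lambda>(F1, F2). F1 \<union> F2) ` (?P1 \<times> ?P2)" by (auto intro!: image_eqI[of _ _ "(F \<inter> arcs D1, F \<inter> arcs D2)"])
    }
  qed
  from sum.reindex_bij_betw[OF this, symmetric]
  have "cp_sum x y z (Digraph_Component.union D1 D2) =
    (\<Sum>(F1, F2) \<in> ?P1 \<times> ?P2. cp_weight x y z ?t ?h (verts D1 \<union> verts D2) (F1 \<union> F2))"
    unfolding cp_sum_def Digraph_Component.union_def by (simp add: case_prod_unfold)
  also have "\<dots> = (\<Sum>(F1, F2) \<in> ?P1 \<times> ?P2. cp_weight x y z ?t ?h (verts D1) F1 * cp_weight x y z ?t ?h (verts D2) F2)"
  proof (intro sum.cong refl, clarify)
    fix F1 F2 assume F: "F1 \<in> ?P1" "F2 \<in> ?P2"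
    then have "finite F1" "finite F2"
      by (auto simp: partial_injs_def intro: finite_subset[OF _ D1.finite_arcs] finite_subset[OF _ D2.finite_arcs])
    then show "cp_weight x y z ?t ?h (verts D1 \<union> verts D2) (F1 \<union> F2) =
      cp_weight x y z ?t ?h (verts D1) F1 * cp_weight x y z ?t ?h (verts D2) F2"
      using F disj V1[of F1] V2[of F2] by (intro cp_weight_disjoint_union) (auto simp: partial_injs_def)
  qed
  also have "\<dots> = cp_sum x y z D1 * cp_sum x y z D2"
    unfolding cp_sum_def eq by (simp add: sum_product sum.cartesian_product)
  finally show ?thesis .
qed

lemma cp_sum_arcless:
  assumes "arcless n D"
  shows "cp_sum x y z D = x ^ n"
proof -
  have "partial_injs t h {} = {{}}" for t h :: "'b \<Rightarrow> 'a" by (auto simp: partial_injs_def)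
  moreover have "cycs t h {} = {}" for t h :: "'b \<Rightarrow> 'a" by (auto simp: cycs_iff)
  ultimately show ?thesis using assms by (simp add: cp_sum_def arcless_def cp_weight_def)
qed

section \<open>The rules determine the invariant\<close>

lemma fin_digraph_contract_arc:
  assumes "fin_digraph D" "e \<in> arcs D"
  shows "fin_digraph (contract_arc D e)"
proof -
  interpret fin_digraph D by fact
  show ?thesis
    using assms(2)
    by (auto simp: contract_arc_def Let_def fin_digraph_del_vert intro!: fin_digraph.intro
      wf_digraph.intro fin_digraph_axioms.intro split: if_splits)
qed

lemma fin_digraph_extract_arc:
  assumes "fin_digraph D"
  shows "fin_digraph (extract_arc D e)"
  unfolding extract_arc_def
  by (intro fin_digraph.fin_digraph_del_vert assms)

text \<open>Multiplicativity splits off one vertex at a time; both pieces keep the end maps of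
  \<open>D\<close> and are thus compatible.\<close>

lemma arc_elimination_invariant_arcless:
  assumes "arc_elimination_invariant f" "arcless n D"
  shows "f D = pX ^ n"
  using assms(2)
proof (induction n arbitrary: D)
  case 0
  then show ?case using assms(1) by (simp add: arc_elimination_invariant_def)
next
  case (Suc n)
  then obtain v where v: "v \<in> verts D" by (auto simp: arcless_def card_Suc_eq)
  interpret fin_digraph D using Suc.prems by (simp add: arcless_def)
  let ?D1 = "D\<lparr>verts := {v}\<rparr>" and ?D2 = "D\<lparr>verts := verts D - {v}\<rparr>"
  have "fin_digraph ?D1" "fin_digraph ?D2"
    using Suc.prems by (auto simp: arcless_def fin_digraph_def wf_digraph_def fin_digraph_axioms_def)
  then have "arcless 1 ?D1" "arcless n ?D2"
    using Suc.prems v by (auto simp: arcless_def)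
  moreover have "Digraph_Component.union ?D1 ?D2 = D"
    using Suc.prems v
    by (intro pre_digraph.equality) (auto simp: Digraph_Component.union_def arcless_def)
  moreover have "f (Digraph_Component.union ?D1 ?D2) = f ?D1 * f ?D2"
    using assms(1) \<open>fin_digraph ?D1\<close> \<open>fin_digraph ?D2\<close>
    by (simp add: arc_elimination_invariant_def compatible_def)
  moreover have "f ?D1 = pX"
    using assms(1) \<open>arcless 1 ?D1\<close> by (simp add: arc_elimination_invariant_def)
  ultimately show ?case using Suc.IH by simp
qed

text \<open>Deletion, contraction and extraction all remove \<open>e\<close> and add no arc, so
  induction on the number of arcs ends at arcless digraphs.\<close>

lemma arc_elimination_invariant_unique:
  assumes f: "arc_elimination_invariant f" and g: "arc_elimination_invariant g" and "fin_digraph D"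
  shows "f D = g D"
  using assms(3)
proof (induction "card (arcs D)" arbitrary: D rule: less_induct)
  case less
  interpret fin_digraph D by fact
  show ?case
  proof (cases "arcs D = {}")
    case True
    then have "arcless (card (verts D)) D" using less.prems by (simp add: arcless_def)
    then show ?thesis using f g by (simp add: arc_elimination_invariant_arcless)
  next
    case False
    then obtain e where e: "e \<in> arcs D" by auto
    have step: "k D = k (del_arc e) + pY * k (contract_arc D e) + pZ * k (extract_arc D e)"
      if "arc_elimination_invariant k" for k
      using that less.prems e by (simp add: arc_elimination_invariant_def)
    have small: "card (arcs H) < card (arcs D)" if "arcs H \<subseteq> arcs D - {e}" for H :: "('a, 'b) pre_digraph"
      using that e by (intro psubset_card_mono) auto
    have "f H = g H" if "H \<in> {del_arc e, contract_arc D e, extract_arc D e}" for H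
    proof (rule less.hyps)
      show "card (arcs H) < card (arcs D)"
        using that by (intro small) (auto simp: contract_arc_def extract_arc_def pre_digraph.del_vert_def Let_def split: if_splits)
      show "fin_digraph H"
        using that fin_digraph_contract_arc[OF less.prems e] fin_digraph_extract_arc[OF less.prems]
          fin_digraph_del_arc by auto
    qed
    then show ?thesis using step[OF f] step[OF g] by simp
  qed
qed

lemma arc_elimination_invariant_cp_sum: "arc_elimination_invariant (cp_sum pX pY pZ)"
  unfolding arc_elimination_invariant_def
  using cp_sum_iso cp_sum_deletion_contraction cp_sum_union
  by (auto simp: cp_sum_arcless)

lemma arc_elimination_poly_eq:
  assumes "fin_digraph D"
  shows "arc_elimination_poly D = cp_sum pX pY pZ D"
  unfolding arc_elimination_poly_def
proof (rule the_equality)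
  show "\<exists>f. arc_elimination_invariant f \<and> f D = cp_sum pX pY pZ D"
    using arc_elimination_invariant_cp_sum by auto
qed (use arc_elimination_invariant_unique[OF _ arc_elimination_invariant_cp_sum assms] in auto)

section \<open>Evaluation and the two identities\<close>

text \<open>Links the degree bounds to injectivity: fibres of the head map are counted by
  in-degrees, those of the tail map by out-degrees.\<close>

lemma inj_on_iff_card_fibres_le_1:
  assumes "finite F" "h ` F \<subseteq> V"
  shows "inj_on h F \<longleftrightarrow> (\<forall>v \<in> V. card {a \<in> F. h a = v} \<le> 1)"
proof
  assume inj: "inj_on h F"
  show "\<forall>v \<in> V. card {a \<in> F. h a = v} \<le> 1"
  proof
    fix v
    have "\<forall>a \<in> {a \<in> F. h a = v}. \<forall>b \<in> {a \<in> F. h a = v}. a = b"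
      using inj by (auto dest: inj_onD)
    then show "card {a \<in> F. h a = v} \<le> 1" using assms(1) by (simp add: card_le_Suc0_iff_eq)
  qed
next
  assume c: "\<forall>v \<in> V. card {a \<in> F. h a = v} \<le> 1"
  show "inj_on h F"
  proof (rule inj_onI)
    fix a b assume ab: "a \<in> F" "b \<in> F" "h a = h b"
    then have "card {c \<in> F. h c = h b} \<le> 1" using c assms(2) by auto
    then show "a = b" using ab assms(1) by (simp add: card_le_Suc0_iff_eq)
  qed
qed

lemma cycle_path_sets_eq:
  assumes "fin_digraph D"
  shows "cycle_path_sets D = partial_injs (tail D) (head D) (arcs D)"
proof -
  interpret fin_digraph D by fact
  have "(\<forall>v \<in> verts D. in_degree (spanning_sub D F) v \<le> 1 \<and> out_degree (spanning_sub D F) v \<le> 1) \<longleftrightarrow>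
    inj_on (tail D) F \<and> inj_on (head D) F" if F: "F \<subseteq> arcs D" for F
  proof -
    have fin: "finite F" "tail D ` F \<subseteq> verts D" "head D ` F \<subseteq> verts D"
      using F finite_subset[OF F] by auto
    show ?thesis
      unfolding inj_on_iff_card_fibres_le_1[OF fin(1,2)] inj_on_iff_card_fibres_le_1[OF fin(1,3)]
      by (auto simp: in_degree_def out_degree_def in_arcs_def out_arcs_def spanning_sub_def)
  qed
  then show ?thesis by (auto simp: cycle_path_sets_def partial_injs_def)
qed

lemma cycle_path_poly_eq:
  assumes "fin_digraph D"
  shows "cycle_path_poly D = (\<Sum>F \<in> partial_injs (tail D) (head D) (arcs D).
    pX ^ card F * pY ^ card (cycs (tail D) (head D) F) * pZ ^ card (tail D ` F - head D ` F))"
  unfolding cycle_path_poly_def cycle_path_sets_eq[OF assms]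
proof (rule sum.cong[OF refl])
  interpret fin_digraph D by fact
  fix F assume "F \<in> partial_injs (tail D) (head D) (arcs D)"
  then have F: "F \<subseteq> arcs D" "inj_on (tail D) F" "inj_on (head D) F" by (auto simp: partial_injs_def)
  interpret S: cycle_path_digraph "spanning_sub D F"
    using F finite_subset[OF F(1)] by unfold_locales (auto simp: spanning_sub_def)
  show "pX ^ card F * pY ^ kc (spanning_sub D F) * pZ ^ kp (spanning_sub D F) =
    pX ^ card F * pY ^ card (cycs (tail D) (head D) F) * pZ ^ card (tail D ` F - head D ` F)"
    unfolding S.kc_eq S.kp_eq by (simp add: spanning_sub_def)
qed

section \<open>Evaluation as a homomorphism\<close>

definition semiring_hom :: "('a::comm_semiring_1 \<Rightarrow> 'b::comm_semiring_1) \<Rightarrow> bool" where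
  "semiring_hom f \<longleftrightarrow> f 0 = 0 \<and> f 1 = 1 \<and> (\<forall>x y. f (x + y) = f x + f y) \<and> (\<forall>x y. f (x * y) = f x * f y)"

lemma semiring_homD:
  assumes "semiring_hom f"
  shows "f 0 = 0" "f 1 = 1" "f (x + y) = f x + f y" "f (x * y) = f x * f y"
  using assms by (auto simp: semiring_hom_def)

lemma semiring_hom_power: "semiring_hom f \<Longrightarrow> f (x ^ n) = f x ^ n"
  by (induction n) (auto simp: semiring_homD)

lemma semiring_hom_sum: "semiring_hom f \<Longrightarrow> f (sum g A) = (\<Sum>a \<in> A. f (g a))"
  by (induction A rule: infinite_finite_induct) (auto simp: semiring_homD)

text \<open>Three applications, starting from \<open>of_int\<close>, cover the three nested
  polynomial layers in \<open>eval3\<close>.\<close>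

lemma semiring_hom_poly_map_poly:
  assumes f: "semiring_hom f"
  shows "semiring_hom (\<lambda>p. poly (map_poly f p) a)"
proof -
  note [simp] = semiring_homD[OF f]
  have "map_poly f 1 = 1" by (simp add: map_poly_1')
  moreover have "map_poly f (p + q) = map_poly f p + map_poly f q" for p q
    by (rule poly_eqI) (simp add: coeff_map_poly)
  moreover have "map_poly f (p * q) = map_poly f p * map_poly f q" for p q
    by (rule poly_eqI) (simp add: coeff_map_poly coeff_mult semiring_hom_sum[OF f])
  ultimately show ?thesis by (simp add: semiring_hom_def)
qed

lemma semiring_hom_eval3: "semiring_hom (\<lambda>p. eval3 p a b c)"
  unfolding eval3_def
  by (intro semiring_hom_poly_map_poly) (simp add: semiring_hom_def)

lemmas eval3_simps =
  semiring_homD[OF semiring_hom_eval3] semiring_hom_power[OF semiring_hom_eval3]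
  semiring_hom_sum[OF semiring_hom_eval3]

lemma eval3_variables:
  "eval3 pX a b c = a" "eval3 pY a b c = b" "eval3 pZ a b c = c"
  by (simp_all add: eval3_def pX_def pY_def pZ_def map_poly_pCons)

lemma eval3_cp_sum: "eval3 (cp_sum pX pY pZ D) a b c = cp_sum a b c D"
  by (simp add: cp_sum_def cp_weight_def eval3_simps eval3_variables)

lemma eval3_cycle_path_poly:
  assumes "fin_digraph D"
  shows "eval3 (cycle_path_poly D) a b c = (\<Sum>F \<in> partial_injs (tail D) (head D) (arcs D).
    a ^ card F * b ^ card (cycs (tail D) (head D) F) * c ^ card (tail D ` F - head D ` F))"
  by (simp add: cycle_path_poly_eq[OF assms] eval3_simps eval3_variables)

section \<open>The identities for a single summand\<close>

text \<open>The covered vertices are the path starts together with the heads, and there is one head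
  per arc.\<close>

lemma card_verts_eq:
  assumes "finite V" "finite F" "t ` F \<union> h ` F \<subseteq> V" "inj_on h F"
  shows "card V = card (V - (t ` F \<union> h ` F)) + card F + card (t ` F - h ` F)"
proof -
  have "card V = card (V - (t ` F \<union> h ` F)) + card (t ` F \<union> h ` F)"
    using assms by (metis card_Diff_subset card_mono finite_subset le_add_diff_inverse2)
  also have "t ` F \<union> h ` F = (t ` F - h ` F) \<union> h ` F" by auto
  also have "card \<dots> = card (t ` F - h ` F) + card (h ` F)"
    using assms by (intro card_Un_disjoint) auto
  finally show ?thesis using assms(4) by (simp add: card_image)
qed

text \<open>The letters count isolated vertices \<open>i\<close>, cycles \<open>c\<close>, paths
  \<open>p\<close>, arcs \<open>f\<close> and vertices \<open>n\<close>. On the right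
  \<open>x\<close> keeps the exponent \<open>n - f - p = i\<close> and \<open>y\<close> the exponent
  \<open>f - c - p = k\<close>.\<close>

lemma arc_elimination_term:
  fixes x y z :: "'a::field"
  assumes "x \<noteq> 0" "y \<noteq> 0" "f = k + (c + p)" "n = i + f + p"
  shows "x ^ i * y ^ k * (y + z) ^ c * (z + x * y) ^ p =
    x ^ n * ((y / x) ^ f * ((y + z) / y) ^ c * (z / (x * y) + 1) ^ p)"
proof -
  have "z / (x * y) + 1 = (z + x * y) / (x * y)" using assms by (simp add: field_simps)
  then show ?thesis
    using assms(1,2) unfolding assms(3,4) by (simp add: power_add power_divide power_mult_distrib)
qed

text \<open>After substitution the cycle factor becomes \<open>x * a * y\<close> and the path factor
  \<open>x * a * a * z\<close>. The powers of \<open>a\<close> add up to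
  \<open>i + k + c + 2 * p = n\<close>, which the prefactor cancels.\<close>

lemma cycle_path_term:
  fixes x y z :: "'a::field"
  assumes "y \<noteq> 1" "z \<noteq> 1" "f = k + (c + p)" "n = i + f + p"
  defines "a \<equiv> (y - 1) / (z - 1)" and "b \<equiv> x * ((y - 1)^2 / (z - 1))"
  shows "x ^ f * y ^ c * z ^ p =
    a powi (- int n) * (a ^ i * (x * a) ^ k * (x * a + b) ^ c * (b + a * (x * a)) ^ p)"
proof -
  have a: "a \<noteq> 0" "a * (z - 1) = y - 1" using assms by (auto simp: a_def)
  have b: "b = x * a * (y - 1)" by (simp add: a_def b_def power2_eq_square)
  have "x * a + b = x * a * y" by (simp add: b algebra_simps)
  moreover have "b + a * (x * a) = x * a * a * z"
    unfolding b a(2)[symmetric] by (simp add: algebra_simps)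
  ultimately have "a ^ i * (x * a) ^ k * (x * a + b) ^ c * (b + a * (x * a)) ^ p =
    a ^ n * (x ^ f * y ^ c * z ^ p)"
    unfolding assms(3,4) by (simp add: power_add power_mult_distrib mult_ac)
  then show ?thesis using a(1) by (simp add: power_int_minus)
qed

theorem theorem4p2:
  fixes D :: "('v, 'e) pre_digraph"
  assumes "fin_digraph D"
  shows
    "eval3 (cycle_path_poly D) rX rY rZ =
       ((rY - 1) / (rZ - 1)) powi (- int (card (verts D))) *
       eval3 (arc_elimination_poly D)
         ((rY - 1) / (rZ - 1))
         (rX * ((rY - 1) / (rZ - 1)))
         (rX * ((rY - 1)^2 / (rZ - 1)))
     \<and>
     eval3 (arc_elimination_poly D) rX rY rZ =
       rX ^ card (verts D) *
       eval3 (cycle_path_poly D)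
         (rY / rX) ((rY + rZ) / rY) (rZ / (rX * rY) + 1)"
proof -
  interpret fin_digraph D by fact
  \<comment> \<open>These make every denominator in the fraction field nonzero, as well as the base
    of the negative power.\<close>
  have nz: "rX \<noteq> 0" "rY \<noteq> 0" "rY \<noteq> 1" "rZ \<noteq> 1"
    by (simp_all add: rX_def rY_def rZ_def pX_def pY_def pZ_def one_pCons flip: to_fract_1)
  have cards: "card F = (card F - (card (cycs (tail D) (head D) F) + card (tail D ` F - head D ` F)))
      + (card (cycs (tail D) (head D) F) + card (tail D ` F - head D ` F))"
    "card (verts D) = card (verts D - (tail D ` F \<union> head D ` F)) + card F + card (tail D ` F - head D ` F)"
    if "F \<in> partial_injs (tail D) (head D) (arcs D)" for F
  proof -
    have F: "F \<subseteq> arcs D" "inj_on (tail D) F" "inj_on (head D) F" "finite F"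
      using that finite_subset[OF _ finite_arcs] by (auto simp: partial_injs_def)
    show "card F = (card F - (card (cycs (tail D) (head D) F) + card (tail D ` F - head D ` F)))
      + (card (cycs (tail D) (head D) F) + card (tail D ` F - head D ` F))"
      using card_cycs_le[OF F(4,2,3)] by simp
    show "card (verts D) = card (verts D - (tail D ` F \<union> head D ` F)) + card F + card (tail D ` F - head D ` F)"
      using F by (intro card_verts_eq) auto
  qed
  show ?thesis
    unfolding arc_elimination_poly_eq[OF assms] eval3_cp_sum eval3_cycle_path_poly[OF assms]
    unfolding cp_sum_def sum_distrib_left cp_weight_def
    by (intro conjI sum.cong refl;
        rule cycle_path_term[OF nz(3,4) cards] arc_elimination_term[OF nz(1,2) cards]; assumption)
qed

end
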